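(* Let $b$ be a finite Blaschke product with $N$ zeros and $C_b=\pi(J^{1/2})\Gamma_b$. (1) If a Cuntz family $S=\{S_i\}_{i=1}^N$ on $L^2(\mathbb{T})$ satisfies $\alpha_S\circ\pi=\pi\circ\beta$ on $L^\infty(\mathbb{T})$, then there is an orthonormal basis $\{m_i\}_{i=1}^N$ of the Hilbert module $L^\infty(\mathbb{T})_{\mathcal{L}}$ such that $S_i=\pi(m_i)C_b$ for $1\le i\le N$. (2) If $\{m_i\}_{i=1}^N\subseteq L^\infty(\mathbb{T})$ is such that the operators $S_i=\pi(m_i)C_b$ form a Cuntz family $S$ with $\alpha_S\circ\pi=\pi\circ\beta$, then $\{m_i\}_{i=1}^N$ is an orthonormal basis of $L^\infty(\mathbb{T})_{\mathcal{L}}$. (3) Conversely, if $\{m_i\}_{i=1}^N$ is any orthonormal basis of $L^\infty(\mathbb{T})_{\mathcal{L}}$ and $S_i=\pi(m_i)C_b$, then $S=\{S_i\}_{i=1}^N$ is a Cuntz family on $L^2(\mathbb{T})$ and $\alpha_S\circ\pi=\pi\circ\beta$ on $L^\infty(\mathbb{T})$.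
   Context: $b=\prod_{j=1}^N b_{\alpha_j}$ is a finite Blaschke product with $N$ zeros in $\mathbb{D}$ ($b_w(z)=\frac{|w|}{w}\frac{w-z}{1-\overline{w}z}$, $b_0(z)=z$); $\beta(\varphi)=\varphi\circ b$ on $L^\infty(\mathbb{T})$. $\pi(\varphi)$ is multiplication by $\varphi$ on $L^2(\mathbb{T})$; $\Gamma_b\xi=\xi\circ b$ (bounded on $L^2(\mathbb{T})$). $J$ is the outer function with $J(0)>0$ and $|J|=J_0$ on $\mathbb{T}$ where $J_0(z)=\frac{zb'(z)}{Nb(z)}$; $J^{1/2}$ its outer square root. The transfer operator is $\mathcal{L}(\xi)(z)=\frac1N\sum_{b(w)=z}\xi(w)$. The Hilbert $C^*$-module $L^\infty(\mathbb{T})_{\mathcal{L}}$ is $L^\infty(\mathbb{T})$ with right action $\xi\cdot a=\xi\beta(a)$ and $L^\infty(\mathbb{T})$-valued inner product $\langle\xi,\eta\rangle=\mathcal{L}(\overline{\xi}\eta)$. A family $\{m_i\}_{i=1}^N$ is an orthonormal basis of it iff $\langle m_i,m_j\rangle=\delta_{ij}\mathbf{1}$ and $f=\sum_{i=1}^N m_i\cdot\langle m_i,f\rangle=\sum_i m_i\,\beta(\mathcal{L}(\overline{m_i}f))$ for all $f\in L^\infty(\mathbb{T})$. A Cuntz family $\{S_i\}$ on $H$ is a family of isometries with $S_i^*S_j=\delta_{ij}I$, $\sum_iS_iS_i^*=I$, and $\alpha_S(T)=\sum_iS_iTS_i^*$. *)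

theory Defs
  imports "HOL-Analysis.Analysis"
begin

text \<open>Normalised Lebesgue measure on the unit circle T, as the push-forward of
  normalised Lebesgue measure on [0, 2 pi] under t mapsto cis t.  Elements of
  L^2(T) and L^infinity(T) are represented by functions complex => complex; equality
  in these spaces is equality almost everywhere with respect to this measure.\<close>

definition circle_measure :: "complex measure" where
  "circle_measure =
     distr (density lborel (\<lambda>t. ennreal (indicator {0..2*pi} t / (2*pi)))) borel cis"

definition L2 :: "(complex \<Rightarrow> complex) \<Rightarrow> bool" where
  "L2 f \<longleftrightarrow> f \<in> borel_measurable circle_measure \<and>
            integrable circle_measure (\<lambda>z. (cmod (f z))\<^sup>2)"

definition Linf :: "(complex \<Rightarrow> complex) \<Rightarrow> bool" where
  "Linf f \<longleftrightarrow> f \<in> borel_measurable circle_measure \<and>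
              (\<exists>C. AE z in circle_measure. cmod (f z) \<le> C)"

definition l2_inner :: "(complex \<Rightarrow> complex) \<Rightarrow> (complex \<Rightarrow> complex) \<Rightarrow> complex" where
  "l2_inner f g = (\<integral>z. cnj (f z) * g z \<partial>circle_measure)"

definition l2_norm :: "(complex \<Rightarrow> complex) \<Rightarrow> real" where
  "l2_norm f = sqrt (\<integral>z. (cmod (f z))\<^sup>2 \<partial>circle_measure)"

type_synonym op = "(complex \<Rightarrow> complex) \<Rightarrow> (complex \<Rightarrow> complex)"

definition bounded_op :: "op \<Rightarrow> bool" where
  "bounded_op T \<longleftrightarrow>
     (\<forall>f. L2 f \<longrightarrow> L2 (T f)) \<and>
     (\<forall>f g. L2 f \<longrightarrow> L2 g \<longrightarrow> (AE z in circle_measure. f z = g z) \<longrightarrow>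
            (AE z in circle_measure. T f z = T g z)) \<and>
     (\<forall>f g c. L2 f \<longrightarrow> L2 g \<longrightarrow>
            (AE z in circle_measure. T (\<lambda>w. f w + c * g w) z = T f z + c * T g z)) \<and>
     (\<exists>C. \<forall>f. L2 f \<longrightarrow> l2_norm (T f) \<le> C * l2_norm f)"

definition op_eq :: "op \<Rightarrow> op \<Rightarrow> bool" where
  "op_eq S T \<longleftrightarrow> (\<forall>f. L2 f \<longrightarrow> (AE z in circle_measure. S f z = T f z))"

definition is_adjoint :: "op \<Rightarrow> op \<Rightarrow> bool" where
  "is_adjoint T Ts \<longleftrightarrow> bounded_op Ts \<and>
     (\<forall>f g. L2 f \<longrightarrow> L2 g \<longrightarrow> l2_inner (Ts f) g = l2_inner f (T g))"

definition op_adjoint :: "op \<Rightarrow> op" where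
  "op_adjoint T = (SOME Ts. is_adjoint T Ts)"

definition cuntz_family :: "nat \<Rightarrow> (nat \<Rightarrow> op) \<Rightarrow> bool" where
  "cuntz_family N S \<longleftrightarrow>
     (\<forall>i<N. bounded_op (S i) \<and> (\<exists>Ts. is_adjoint (S i) Ts)) \<and>
     (\<forall>i<N. \<forall>j<N. op_eq (\<lambda>f. op_adjoint (S i) (S j f))
                        (if i = j then (\<lambda>f. f) else (\<lambda>f z. 0))) \<and>
     op_eq (\<lambda>f z. \<Sum>i<N. S i (op_adjoint (S i) f) z) (\<lambda>f. f)"

definition alpha_S :: "nat \<Rightarrow> (nat \<Rightarrow> op) \<Rightarrow> op \<Rightarrow> op" where
  "alpha_S N S T = (\<lambda>f z. \<Sum>i<N. S i (T (op_adjoint (S i) f)) z)"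

definition mult_op :: "(complex \<Rightarrow> complex) \<Rightarrow> op" where
  "mult_op \<phi> = (\<lambda>f z. \<phi> z * f z)"

definition blaschke_factor :: "complex \<Rightarrow> complex \<Rightarrow> complex" where
  "blaschke_factor w z =
     (if w = 0 then z else (of_real (cmod w) / w) * ((w - z) / (1 - cnj w * z)))"

definition blaschke :: "nat \<Rightarrow> (nat \<Rightarrow> complex) \<Rightarrow> complex \<Rightarrow> complex" where
  "blaschke N \<alpha> z = (\<Prod>j<N. blaschke_factor (\<alpha> j) z)"

definition beta :: "(complex \<Rightarrow> complex) \<Rightarrow> (complex \<Rightarrow> complex) \<Rightarrow> (complex \<Rightarrow> complex)" where
  "beta b \<phi> = (\<lambda>z. \<phi> (b z))"

definition J0 :: "nat \<Rightarrow> (nat \<Rightarrow> complex) \<Rightarrow> complex \<Rightarrow> complex" where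
  "J0 N \<alpha> z = z * deriv (blaschke N \<alpha>) z / (of_nat N * blaschke N \<alpha> z)"

definition herglotz :: "(complex \<Rightarrow> real) \<Rightarrow> complex \<Rightarrow> complex" where
  "herglotz u z = (\<integral>\<zeta>. (\<zeta> + z) / (\<zeta> - z) * of_real (u \<zeta>) \<partial>circle_measure)"

text \<open>The outer function J with J(0) > 0 and |J| = J_0 on T is exp of the
  Herglotz integral of log J_0; its outer square root is J^{1/2} = exp of half of it.\<close>
definition J_outer :: "nat \<Rightarrow> (nat \<Rightarrow> complex) \<Rightarrow> complex \<Rightarrow> complex" where
  "J_outer N \<alpha> z = exp (herglotz (\<lambda>\<zeta>. ln (cmod (J0 N \<alpha> \<zeta>))) z)"

definition J_sqrt :: "nat \<Rightarrow> (nat \<Rightarrow> complex) \<Rightarrow> complex \<Rightarrow> complex" where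
  "J_sqrt N \<alpha> z = exp (herglotz (\<lambda>\<zeta>. ln (cmod (J0 N \<alpha> \<zeta>))) z / 2)"

text \<open>Boundary values on T (radial limits) of J^{1/2}; this is the element of
  L^infinity(T) that J^{1/2} in H^infinity corresponds to.\<close>
definition J_sqrt_bd :: "nat \<Rightarrow> (nat \<Rightarrow> complex) \<Rightarrow> complex \<Rightarrow> complex" where
  "J_sqrt_bd N \<alpha> \<zeta> = Lim (at_left 1) (\<lambda>r::real. J_sqrt N \<alpha> (of_real r * \<zeta>))"

definition C_b :: "nat \<Rightarrow> (nat \<Rightarrow> complex) \<Rightarrow> op" where
  "C_b N \<alpha> = (\<lambda>f z. J_sqrt_bd N \<alpha> z * f (blaschke N \<alpha> z))"

definition transfer :: "nat \<Rightarrow> (complex \<Rightarrow> complex) \<Rightarrow> (complex \<Rightarrow> complex) \<Rightarrow> (complex \<Rightarrow> complex)" where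
  "transfer N b \<xi> = (\<lambda>z. (1 / of_nat N) * (\<Sum>w\<in>{w. b w = z}. \<xi> w))"

text \<open>Orthonormal basis {m_i}, i < N, of the Hilbert module L^infinity(T)_L:
  <xi,eta> = L(conj xi * eta), right action xi . a = xi beta(a).\<close>
definition module_inner :: "nat \<Rightarrow> (complex \<Rightarrow> complex) \<Rightarrow> (complex \<Rightarrow> complex) \<Rightarrow> (complex \<Rightarrow> complex) \<Rightarrow> (complex \<Rightarrow> complex)" where
  "module_inner N b \<xi> \<eta> = transfer N b (\<lambda>w. cnj (\<xi> w) * \<eta> w)"

definition module_onb :: "nat \<Rightarrow> (complex \<Rightarrow> complex) \<Rightarrow> (nat \<Rightarrow> complex \<Rightarrow> complex) \<Rightarrow> bool" where
  "module_onb N b m \<longleftrightarrow>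
     (\<forall>i<N. Linf (m i)) \<and>
     (\<forall>i<N. \<forall>j<N. AE z in circle_measure.
         module_inner N b (m i) (m j) z = (if i = j then 1 else 0)) \<and>
     (\<forall>f. Linf f \<longrightarrow> (AE z in circle_measure.
         f z = (\<Sum>i<N. m i z * beta b (module_inner N b (m i) f) z)))"

end

(* The boundary map of b lifts to an increasing diffeomorphism "phase" of the line whose derivative
   is N J_0 and which advances by 2 pi N per turn.  Substituting along its inverse gives
   integral(xi J_0) = integral(L xi).  Since log J_0 is Lipschitz on the circle, the Herglotz integral
   has radial limits and k = J^(1/2) satisfies |k|^2 = J_0 there; hence pi(m) C_b is bounded with
   adjoint h |-> L(conj(m) h / k), and (2) and (3) become pointwise identities on the fibres of b.
   For (1), the Cuntz relations turn alpha_S pi = pi beta into S_i(phi f) = (phi o b) S_i f, so that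
   S_i f = (f o b) S_i 1; since S_i is isometric, m_i = S_i 1 / k satisfies L(|m_i|^2) = 1 and is
   therefore bounded by sqrt N. *)
theory Submission
  imports Defs "HOL-Complex_Analysis.Cauchy_Integral_Formula"
begin

section \<open>Arc length\<close>

text \<open>Elements of L^2 and L^infinity are plain functions on the complex plane, and this shapes
  much of the proof. \<open>transfer\<close> sums over a set-theoretic fibre, whose size off the
  circle and measurability in z are unclear; it is replaced by a sum over N Borel branches
  \<open>preim\<close>. \<open>J_sqrt_bd\<close> is a radial limit at every point of the plane, so
  its Borel measurability calls for convergence off the circle too. \<open>op_adjoint\<close> is a
  choice, fixed only up to null sets at each argument, so it has to be compared with an explicit
  adjoint before anything can be computed. The second obstacle is boundedness: the module and the
  covariance relation speak of bounded functions, the Cuntz relations of all of L^2. No density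
  argument bridges this. Fibres are finite, so truncation extends the reconstruction formula
  pointwise; and an L^2 function f is the quotient of the bounded functions f/(1+|f|) and 1/(1+|f|),
  to which the covariance relation applies.\<close>

lemma measurable_cis [measurable]: "cis \<in> borel_measurable borel"
  by (intro borel_measurable_continuous_onI continuous_on_cis continuous_on_id)

lemma sets_circle_measure [simp, measurable_cong]: "sets circle_measure = sets borel"
  by (simp add: circle_measure_def)

lemma space_circle_measure [simp]: "space circle_measure = UNIV"
  by (simp add: circle_measure_def)

lemma nn_integral_circle_measure:
  assumes [measurable]: "f \<in> borel_measurable borel"
  shows "(\<integral>\<^sup>+z. f z \<partial>circle_measure)
    = ennreal (1 / (2*pi)) * (\<integral>\<^sup>+t. f (cis t) * indicator {0..2*pi} t \<partial>lborel)"
proof -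
  have "(\<integral>\<^sup>+z. f z \<partial>circle_measure)
     = (\<integral>\<^sup>+t. f (cis t) \<partial>density lborel (\<lambda>t. ennreal (indicator {0..2*pi} t / (2*pi))))"
    unfolding circle_measure_def by (subst nn_integral_distr) auto
  also have "\<dots> = (\<integral>\<^sup>+t. ennreal (1 / (2*pi)) * (f (cis t) * indicator {0..2*pi} t) \<partial>lborel)"
    by (subst nn_integral_density) (auto intro!: nn_integral_cong simp: indicator_def ac_simps)
  also have "\<dots> = ennreal (1 / (2*pi)) * (\<integral>\<^sup>+t. f (cis t) * indicator {0..2*pi} t \<partial>lborel)"
    by (subst nn_integral_cmult) auto
  finally show ?thesis .
qed

lemma AE_circle_measure_cmod: "AE z in circle_measure. cmod z = 1"
proof -
  have "{z. cmod z = 1} \<in> sets borel" by measurable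
  then show ?thesis unfolding circle_measure_def by (subst AE_distr_iff) (auto simp: AE_density)
qed

lemma emeasure_circle_measure_UNIV: "emeasure circle_measure UNIV = 1"
proof -
  have "(\<integral>\<^sup>+z. 1 \<partial>circle_measure) = ennreal (1 / (2*pi)) * ennreal (2*pi)"
    by (subst nn_integral_circle_measure) auto
  also have "\<dots> = 1" by (subst ennreal_mult[symmetric]) auto
  finally show ?thesis by simp
qed

interpretation circle: finite_measure circle_measure
  by standard (simp add: emeasure_circle_measure_UNIV)

text \<open>The primitive \<open>F\<close> need not be periodic: its increment over one turn,
  divided by 2 pi, is the integral. The mean of the Herglotz kernel is computed this way.\<close>

lemma has_bochner_integral_circle_measure:
  fixes F :: "real \<Rightarrow> complex"
  assumes [measurable]: "f \<in> borel_measurable borel"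
    and "\<And>t. (F has_vector_derivative f (cis t)) (at t)"
    and "continuous_on UNIV (\<lambda>t. f (cis t))"
  shows "has_bochner_integral circle_measure f ((F (2*pi) - F 0) / (2*pi))"
proof -
  have 1: "has_bochner_integral lborel (\<lambda>t. indicator {0..2*pi} t *\<^sub>R f (cis t)) (F (2*pi) - F 0)"
    by (rule has_bochner_integral_FTC_Icc)
       (auto intro: has_vector_derivative_at_within assms continuous_on_subset[OF assms(3)])
  have "has_bochner_integral lborel (\<lambda>t. (indicator {0..2*pi} t / (2*pi)) *\<^sub>R f (cis t)) ((F (2*pi) - F 0) / (2*pi))"
    using has_bochner_integral_scaleR_right[OF 1, of "1 / (2*pi)"]
    by (simp add: scaleR_conv_of_real field_simps)
  then have "has_bochner_integral (density lborel (\<lambda>t. ennreal (indicator {0..2*pi} t / (2*pi)))) (\<lambda>t. f (cis t)) ((F (2*pi) - F 0) / (2*pi))"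
    by (intro has_bochner_integral_density) auto
  then show ?thesis unfolding circle_measure_def
    by (intro has_bochner_integral_distr) auto
qed

text \<open>The image of [0, 2 pi] under the lift of b starts at \<open>phase 0\<close>, not at 0;
  this moves the window back. Translating by a multiple of the period reduces to a start
  \<open>a0\<close> in [0, p], where the window is cut at p and its overhang is moved to the
  front.\<close>

lemma nn_integral_period_interval:
  fixes f :: "real \<Rightarrow> ennreal"
  assumes [measurable]: "f \<in> borel_measurable borel" and p: "p > 0" and per: "\<And>x. f (x + p) = f x"
  shows "(\<integral>\<^sup>+x. f x * indicator {a..a+p} x \<partial>lborel) = (\<integral>\<^sup>+x. f x * indicator {0..p} x \<partial>lborel)"
proof -
  \<comment> \<open>Half-open intervals make adjacent pieces disjoint, so additivity is exact; the
    missing endpoint is restored as a null set at the end.\<close>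
  define I where "I a b = (\<integral>\<^sup>+x. f x * indicator {a..<b} x \<partial>lborel)" for a b
  have I: "I a c = I a b + I b c" if "a \<le> b" "b \<le> c" for a b c
  proof -
    have "I a c = (\<integral>\<^sup>+x. f x * indicator {a..<b} x + f x * indicator {b..<c} x \<partial>lborel)"
      unfolding I_def using that by (intro nn_integral_cong) (auto simp: indicator_def)
    then show ?thesis unfolding I_def by (subst (asm) nn_integral_add) auto
  qed
  have per_int: "f (x + of_int k * p) = f x" for x k
  proof -
    have n: "f (x + real n * p) = f x" for x n
    proof (induction n)
      case (Suc n)
      then show ?case using per[of "x + real n * p"] by (simp add: algebra_simps)
    qed simp
    show ?thesis
    proof (cases "k \<ge> 0")
      case True then show ?thesis using n[of x "nat k"] by simp
    next
      case False then show ?thesis using n[of "x + of_int k * p" "nat (-k)"] by (simp add: algebra_simps)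
    qed
  qed
  have shift: "I (a + of_int k * p) (b + of_int k * p) = I a b" for a b k
    unfolding I_def
    by (subst nn_integral_real_affine[where c=1 and t="of_int k * p"])
       (auto intro!: nn_integral_cong simp: indicator_def per_int add.commute[of "of_int k * p"])
  define k where "k = \<lfloor>a / p\<rfloor>"
  define a0 where "a0 = a - of_int k * p"
  have a0: "0 \<le> a0" "a0 \<le> p"
    using p floor_divide_lower[OF p, of a] floor_divide_upper[OF p, of a] unfolding a0_def k_def
    by (auto simp: algebra_simps)
  have "I a (a + p) = I a0 (a0 + p)"
    using shift[of a0 k "a0 + p"] by (simp add: a0_def)
  also have "\<dots> = I a0 p + I p (a0 + p)" using a0 by (intro I) auto
  also have "I p (a0 + p) = I 0 a0" using shift[of 0 1 a0] by simp
  also have "I a0 p + I 0 a0 = I 0 p" using I[of 0 a0 p] a0 by (simp add: add.commute)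
  finally have "I a (a + p) = I 0 p" .
  moreover have "I a b = (\<integral>\<^sup>+x. f x * indicator {a..b} x \<partial>lborel)" for a b
    unfolding I_def
  proof (rule nn_integral_cong_AE)
    show "AE x in lborel. f x * indicator {a..<b} x = f x * indicator {a..b} x"
      using AE_lborel_singleton[of b] by eventually_elim (auto simp: indicator_def)
  qed
  ultimately show ?thesis by simp
qed

section \<open>The boundary map of a Blaschke product\<close>

text \<open>A smooth branch of the argument of a Blaschke factor along the circle:
  \<open>1 - w * cis (- t)\<close> stays in the right half-plane, so its principal logarithm never
  meets the cut. The \<open>Arg\<close> term accounts for the unimodular constant -|w|/w and is
  replaced by 0 for w = 0, where the factor is z itself.\<close>

definition factor_phase :: "complex \<Rightarrow> real \<Rightarrow> real" where
  "factor_phase w t = (if w = 0 then 0 else Arg (- (of_real (cmod w) / w))) + t + 2 * Im (Ln (1 - w * cis (- t)))"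

lemma one_minus_nonneg_Reals:
  assumes "cmod v < 1" shows "1 - v \<notin> \<real>\<^sub>\<le>\<^sub>0"
proof -
  have "Re v \<le> cmod v" by (rule complex_Re_le_cmod)
  then show ?thesis using assms by (auto simp: complex_nonpos_Reals_iff)
qed

lemma cis_two_Im_Ln:
  assumes "q \<noteq> 0" shows "cis (2 * Im (Ln q)) = q / cnj q"
proof -
  have "cis (2 * Im (Ln q)) = exp (Ln q - cnj (Ln q))"
    by (simp add: cis_conv_exp complex_diff_cnj mult.commute)
  also have "\<dots> = q / cnj q" using assms by (simp add: exp_diff exp_cnj[symmetric])
  finally show ?thesis .
qed

text \<open>With q = 1 - w cis(-t) the numerator is -cis(t) q and the denominator is the conjugate
  of q, and q / cnj q has twice the argument of q. The sign joins the constant |w|/w.\<close>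

lemma blaschke_factor_cis:
  assumes w: "cmod w < 1"
  shows "blaschke_factor w (cis t) = cis (factor_phase w t)"
proof -
  let ?q = "1 - w * cis (- t)"
  have "cmod (w * cis (-t)) < 1" using w by (simp add: norm_mult)
  then have q: "?q \<noteq> 0" by auto
  have "cis t * cis (-t) = 1" by (simp add: cis_mult)
  then have e1: "w - cis t = - cis t * ?q" by (simp add: algebra_simps)
  have e2: "1 - cnj w * cis t = cnj ?q" by (simp add: cis_cnj)
  have "(w - cis t) / (1 - cnj w * cis t) = - (cis t * cis (2 * Im (Ln ?q)))"
    unfolding cis_two_Im_Ln[OF q] e1 e2 by simp
  also have "\<dots> = - cis (t + 2 * Im (Ln ?q))" by (simp only: cis_mult)
  finally have e: "(w - cis t) / (1 - cnj w * cis t) = - cis (t + 2 * Im (Ln ?q))" .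
  show ?thesis
  proof (cases "w = 0")
    case True then show ?thesis by (simp add: blaschke_factor_def factor_phase_def)
  next
    case False
    have "cis (Arg (- (of_real (cmod w) / w))) = - (cmod w / w)"
      using False by (subst cis_Arg) (auto simp: sgn_div_norm norm_divide)
    then show ?thesis
      using False by (simp add: blaschke_factor_def factor_phase_def e add.assoc flip: cis_mult)
  qed
qed

text \<open>With v = w cis(-t) the derivative is 1 + 2 Re (v/(1-v)) = Re ((1+v)/(1-v)), which is the
  Poisson kernel of w.\<close>

lemma factor_phase_has_derivative:
  assumes w: "cmod w < 1"
  shows "(factor_phase w has_real_derivative (1 - (cmod w)\<^sup>2) / (cmod (cis t - w))\<^sup>2) (at t)"
proof -
  define v where "v = w * cis (- t)"
  have v: "cmod v < 1" using w by (simp add: v_def norm_mult)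
  then have v1: "1 - v \<noteq> 0" by auto
  have "((\<lambda>t. 1 - w * cis (- t)) has_vector_derivative \<i> * v) (at t)"
    unfolding v_def has_vector_derivative_def
    by (auto intro!: derivative_eq_intros simp: scaleR_conv_of_real algebra_simps)
  then have "((\<lambda>t. Ln (1 - w * cis (- t))) has_vector_derivative \<i> * v * inverse (1 - v)) (at t)"
    using field_vector_diff_chain_at[of "\<lambda>t. 1 - w * cis (- t)" "\<i> * v" t Ln "inverse (1 - v)"]
      one_minus_nonneg_Reals[OF v]
    by (simp add: o_def v_def has_field_derivative_Ln)
  then have "((\<lambda>t. Im (Ln (1 - w * cis (- t)))) has_real_derivative Im (\<i> * v * inverse (1 - v))) (at t)"
    unfolding has_real_derivative_iff_has_vector_derivative
    by (rule bounded_linear.has_vector_derivative[OF bounded_linear_Im])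
  then have "((\<lambda>t. (if w = 0 then 0 else Arg (- (of_real (cmod w) / w))) + t + 2 * Im (Ln (1 - w * cis (- t))))
      has_real_derivative 0 + 1 + 2 * Im (\<i> * v * inverse (1 - v))) (at t)"
    by (intro DERIV_add DERIV_const DERIV_ident DERIV_cmult)
  then have d: "(factor_phase w has_real_derivative (1 + 2 * Re (v / (1 - v)))) (at t)"
    unfolding factor_phase_def[abs_def] by (simp add: divide_inverse mult.assoc)
  have "1 + 2 * Re (v / (1 - v)) = Re ((1 + v) / (1 - v))"
  proof -
    have "(1 + v) / (1 - v) = 1 + v / (1 - v) + v / (1 - v)" using v1 by (simp add: field_simps)
    then show ?thesis by (metis (no_types) Re_complex_of_real add.assoc complex_Re_numeral mult_2 one_complex.simps(1) plus_complex.simps(1))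
  qed
  also have "\<dots> = (1 - (cmod v)\<^sup>2) / (cmod (1 - v))\<^sup>2"
  proof -
    have "Re ((1 + v) * cnj (1 - v)) = 1 - (cmod v)\<^sup>2"
      unfolding cmod_power2 by (simp add: algebra_simps power2_eq_square)
    then show ?thesis by (subst complex_div_cnj) (simp flip: of_real_power)
  qed
  also have "cmod v = cmod w" by (simp add: v_def norm_mult)
  also have "cmod (1 - v) = cmod (cis t - w)"
  proof -
    have "cis t * (1 - v) = cis t - w" by (simp add: v_def algebra_simps cis_mult)
    then show ?thesis by (metis norm_mult norm_cis mult_1)
  qed
  finally show ?thesis using d by simp
qed

lemma factor_phase_period: "factor_phase w (t + 2*pi) = factor_phase w t + 2*pi"
proof -
  have "cis (- (t + 2*pi)) = cis (-t) / cis (2*pi)" unfolding cis_divide by simp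
  then have "cis (- (t + 2*pi)) = cis (-t)" by simp
  then show ?thesis by (simp add: factor_phase_def)
qed

section \<open>Modulus and differentiability of a single Blaschke factor\<close>

text \<open>The sign of the right-hand side decides whether a factor with zero w in the disc has
  modulus below or above 1 at z.\<close>

lemma cmod_blaschke_factor_numerator:
  "(cmod (1 - cnj w * z))\<^sup>2 - (cmod (w - z))\<^sup>2 = (1 - (cmod w)\<^sup>2) * (1 - (cmod z)\<^sup>2)"
  unfolding cmod_power2 by (simp add: power2_eq_square algebra_simps)

lemma cmod_blaschke_factor:
  "cmod (blaschke_factor w z) = cmod (w - z) / cmod (1 - cnj w * z)"
  by (simp add: blaschke_factor_def norm_mult norm_divide)

lemma cmod_blaschke_factor_less_1:
  assumes "cmod w < 1" "cmod z < 1" shows "cmod (blaschke_factor w z) < 1"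
proof -
  have "(1 - (cmod w)\<^sup>2) * (1 - (cmod z)\<^sup>2) > 0"
    using assms by (intro mult_pos_pos) (simp_all add: abs_square_less_1)
  then have "(cmod (w - z))\<^sup>2 < (cmod (1 - cnj w * z))\<^sup>2"
    using cmod_blaschke_factor_numerator[of w z] by linarith
  then have "cmod (w - z) < cmod (1 - cnj w * z)" by (rule power_less_imp_less_base) simp
  then show ?thesis unfolding cmod_blaschke_factor by (subst divide_less_eq_1) auto
qed

text \<open>The first alternative is the pole 1 / cnj w, where division by zero gives the value
  0.\<close>

lemma cmod_blaschke_factor_greater_1:
  assumes "cmod w < 1" "cmod z > 1"
  shows "blaschke_factor w z = 0 \<or> cmod (blaschke_factor w z) > 1"
proof -
  have "(1 - (cmod w)\<^sup>2) * (1 - (cmod z)\<^sup>2) < 0"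
    using assms by (intro mult_pos_neg) (auto simp: abs_square_less_1 one_less_power)
  then have "(cmod (1 - cnj w * z))\<^sup>2 < (cmod (w - z))\<^sup>2"
    using cmod_blaschke_factor_numerator[of w z] by linarith
  then have *: "cmod (1 - cnj w * z) < cmod (w - z)" by (rule power_less_imp_less_base) simp
  show ?thesis
  proof (cases "1 - cnj w * z = 0")
    case True then show ?thesis by (auto simp: blaschke_factor_def)
  next
    case False then show ?thesis using * unfolding cmod_blaschke_factor by (simp add: less_divide_eq)
  qed
qed

lemma blaschke_factor_differentiable:
  assumes "cmod w < 1" "cmod z \<le> 1"
  shows "(blaschke_factor w) field_differentiable (at z)"
proof (cases "w = 0")
  case True then show ?thesis by (simp add: blaschke_factor_def[abs_def])
next
  case False
  have "cmod (cnj w * z) < 1" using assms mult_less_le_imp_less[of "cmod w" 1 "cmod z" 1]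
    by (cases "z = 0") (auto simp: norm_mult)
  then have "1 - cnj w * z \<noteq> 0" by auto
  then show ?thesis using False unfolding blaschke_factor_def[abs_def]
    by (auto intro!: derivative_intros)
qed

lemma measurable_blaschke_factor [measurable]: "blaschke_factor w \<in> borel_measurable borel"
  unfolding blaschke_factor_def[abs_def] by measurable

lemma measurable_blaschke [measurable]: "blaschke N \<alpha> \<in> borel_measurable borel"
  unfolding blaschke_def[abs_def] by measurable

section \<open>The lift of a Blaschke product to the line\<close>

locale blaschke_product =
  fixes N :: nat and \<alpha> :: "nat \<Rightarrow> complex"
  assumes N_pos: "N \<ge> 1" and zeros: "\<forall>j<N. cmod (\<alpha> j) < 1"
begin

abbreviation b :: "complex \<Rightarrow> complex" where "b \<equiv> blaschke N \<alpha>"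

text \<open>The sum of the Poisson kernels of the zeros: an explicit, visibly positive form of z
  b'(z) / b(z) on the circle, free of \<open>deriv\<close>.\<close>

definition poisson_sum :: "complex \<Rightarrow> real" where
  "poisson_sum z = (\<Sum>j<N. (1 - (cmod (\<alpha> j))\<^sup>2) / (cmod (z - \<alpha> j))\<^sup>2)"

definition phase :: "real \<Rightarrow> real" where
  "phase t = (\<Sum>j<N. factor_phase (\<alpha> j) t)"

lemma measurable_poisson_sum [measurable]: "poisson_sum \<in> borel_measurable borel"
  unfolding poisson_sum_def[abs_def] by measurable

lemma poisson_sum_pos:
  assumes "cmod z = 1" shows "poisson_sum z > 0"
  unfolding poisson_sum_def
proof (rule sum_pos)
  fix j assume "j \<in> {..<N}"
  then have "cmod (\<alpha> j) < 1" using zeros by simp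
  moreover from this have "z \<noteq> \<alpha> j" using assms by auto
  ultimately show "(1 - (cmod (\<alpha> j))\<^sup>2) / (cmod (z - \<alpha> j))\<^sup>2 > 0"
    by (intro divide_pos_pos) (simp_all add: abs_square_less_1)
qed (use N_pos in \<open>auto simp: lessThan_empty_iff\<close>)

lemma blaschke_cis: "b (cis t) = cis (phase t)"
proof -
  have "(\<Prod>j<n. blaschke_factor (\<alpha> j) (cis t)) = cis (\<Sum>j<n. factor_phase (\<alpha> j) t)" if "n \<le> N" for n
    using that
  proof (induction n)
    case (Suc n)
    then show ?case using zeros by (simp add: blaschke_factor_cis cis_mult)
  qed simp
  then show ?thesis by (simp add: blaschke_def phase_def)
qed

lemma cmod_eq_1_cis: assumes "cmod z = 1" obtains t where "z = cis t"
  using assms by (metis rcis_Ex cis_rcis_eq rcis_cmod_Arg)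

text \<open>The fibre in \<open>transfer\<close> ranges over the whole plane; this confines the
  fibre over a point of the circle to the circle. Off the circle, the factors all have modulus below
  1 or, once |b z| = 1 has excluded vanishing factors, all above 1.\<close>

lemma cmod_blaschke_eq_1_iff: "cmod (b z) = 1 \<longleftrightarrow> cmod z = 1"
proof
  assume *: "cmod (b z) = 1"
  have n: "cmod (b z) = (\<Prod>j<N. cmod (blaschke_factor (\<alpha> j) z))"
    by (simp add: blaschke_def prod_norm)
  have nz: "blaschke_factor (\<alpha> j) z \<noteq> 0" if "j < N" for j
  proof -
    have "b z \<noteq> 0" using * by auto
    then show ?thesis using that by (auto simp: blaschke_def prod_zero_iff)
  qed
  have N0: "{..<N} \<noteq> {}" using N_pos by (auto simp: lessThan_empty_iff)
  show "cmod z = 1"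
  proof (rule ccontr)
    assume "cmod z \<noteq> 1"
    then consider "cmod z < 1" | "cmod z > 1" by linarith
    then show False
    proof cases
      case 1
      have "(\<Prod>j<N. cmod (blaschke_factor (\<alpha> j) z)) < (\<Prod>j<N. 1)"
        using 1 zeros N0 nz by (intro prod_mono_strict) (auto intro: cmod_blaschke_factor_less_1 less_imp_le[OF cmod_blaschke_factor_less_1])
      then show False using * n by simp
    next
      case 2
      have "(\<Prod>j<N. 1) < (\<Prod>j<N. cmod (blaschke_factor (\<alpha> j) z))"
        using 2 zeros N0 nz cmod_blaschke_factor_greater_1 by (intro prod_mono_strict) fastforce+
      then show False using * n by simp
    qed
  qed
next
  assume "cmod z = 1" then show "cmod (b z) = 1"
    by (metis blaschke_cis norm_cis cmod_eq_1_cis)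
qed

lemma phase_has_derivative: "(phase has_real_derivative poisson_sum (cis t)) (at t)"
  unfolding phase_def[abs_def] poisson_sum_def using zeros
  by (intro DERIV_sum) (auto intro: factor_phase_has_derivative)

lemma continuous_on_poisson_sum: "continuous_on UNIV (\<lambda>t. poisson_sum (cis t))"
  unfolding poisson_sum_def
proof (intro continuous_intros continuous_on_cis ballI)
  fix j t assume "j \<in> {..<N}"
  then have "cmod (\<alpha> j) < 1" using zeros by simp
  then have "cis t \<noteq> \<alpha> j" by (metis norm_cis less_irrefl)
  then show "(cmod (cis t - \<alpha> j))\<^sup>2 \<noteq> 0" by simp
qed

lemma phase_strict_mono: "strict_mono phase"
proof (rule strict_monoI)
  fix x y :: real assume "x < y"
  then show "phase x < phase y"
    by (rule DERIV_pos_imp_increasing) (meson phase_has_derivative poisson_sum_pos norm_cis)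
qed

lemma phase_period_nat: "phase (t + 2*pi * real n) = phase t + 2*pi * real N * real n"
proof (induction n)
  case (Suc n)
  have "phase (t + 2*pi * real n + 2*pi) = phase (t + 2*pi * real n) + 2*pi * real N"
    by (simp add: phase_def factor_phase_period sum.distrib)
  then show ?case using Suc by (simp add: algebra_simps)
qed simp

lemma phase_period: "phase (t + 2*pi * of_int n) = phase t + 2*pi * real N * of_int n"
proof (cases "n \<ge> 0")
  case True then show ?thesis using phase_period_nat[of t "nat n"] by simp
next
  case False
  then show ?thesis using phase_period_nat[of "t + 2*pi * of_int n" "nat (-n)"]
    by (simp add: algebra_simps)
qed

lemma continuous_on_phase: "continuous_on A phase"
  by (meson DERIV_continuous_on has_field_derivative_at_within phase_has_derivative)

lemma phase_surj: "\<exists>t. phase t = s"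
proof -
  have N: "real N \<ge> 1" using N_pos by simp
  obtain n :: nat where n: "\<bar>s\<bar> + \<bar>phase 0\<bar> < real n" using reals_Archimedean2 by blast
  have "real n * 1 \<le> 2*pi * real N * real n"
  proof -
    have "1 * 1 \<le> (2*pi) * real N" using N pi_ge_two by (intro mult_mono) auto
    then show ?thesis using mult_right_mono[of 1 "2*pi * real N" "real n"] by simp
  qed
  then have 1: "\<bar>s\<bar> + \<bar>phase 0\<bar> < 2*pi * real N * real n" using n by simp
  have "phase (0 + 2*pi * of_int (int n)) \<ge> s" "phase (0 + 2*pi * of_int (- int n)) \<le> s"
    unfolding phase_period using 1 by (auto simp: algebra_simps)
  moreover have "0 + 2*pi * of_int (- int n) \<le> 0 + 2*pi * of_int (int n)" by simp
  ultimately show ?thesis using IVT'[of phase _ s] continuous_on_phase by metis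
qed

section \<open>Inverse of the lift and the N points of a fibre\<close>

definition phase_inv :: "real \<Rightarrow> real" where "phase_inv = inv phase"

lemma phase_phase_inv [simp]: "phase (phase_inv s) = s"
  unfolding phase_inv_def using phase_surj by (metis surj_def surj_f_inv_f)

lemma phase_inv_phase [simp]: "phase_inv (phase t) = t"
  unfolding phase_inv_def by (simp add: phase_strict_mono strict_mono_imp_inj_on)

lemma phase_inv_mono: "mono phase_inv"
  using phase_strict_mono by (intro monoI) (metis phase_phase_inv strict_mono_less_eq)

lemma measurable_phase_inv [measurable]: "phase_inv \<in> borel_measurable borel"
  by (rule borel_measurable_mono[OF phase_inv_mono])

lemma phase_inv_period: "phase_inv (s + 2*pi * real N * of_int n) = phase_inv s + 2*pi * of_int n"
  by (metis phase_period phase_phase_inv phase_inv_phase)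

lemma cis_eq_cis_iff: "cis s = cis t \<longleftrightarrow> (\<exists>n::int. s = t + 2*pi * of_int n)"
proof
  assume "cis s = cis t"
  then show "\<exists>n::int. s = t + 2*pi * of_int n"
    using sin_cos_eq_iff[of s t] by (auto simp: complex_eq_iff algebra_simps)
next
  assume "\<exists>n::int. s = t + 2*pi * of_int n"
  then show "cis s = cis t" by (auto simp: cis_mult[symmetric])
qed

text \<open>Points cis t of the fibre are the solutions of phase t = s + 2 pi n with n an integer.
  Raising n by N advances t by a full turn, so the residue of n modulo N determines the
  point.\<close>

lemma fiber_cis: "{w. b w = cis s} = (\<lambda>k. cis (phase_inv (s + 2*pi * real k))) ` {..<N}"
proof (intro equalityI subsetI)
  fix w assume "w \<in> {w. b w = cis s}"
  then have w: "b w = cis s" by simp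
  then have "cmod w = 1" using cmod_blaschke_eq_1_iff[of w] by simp
  then obtain t where t: "w = cis t" by (rule cmod_eq_1_cis)
  obtain n where n: "phase t = s + 2*pi * of_int n"
    using w cis_eq_cis_iff unfolding t blaschke_cis by blast
  define k where "k = nat (n mod int N)"
  have k: "k < N" "int k = n mod int N" using N_pos by (auto simp: k_def nat_less_iff)
  have "n = int k + int N * (n div int N)" using k by simp
  then have rn: "real_of_int n = real k + real N * of_int (n div int N)"
    by (metis of_int_add of_int_mult of_int_of_nat_eq)
  have "s + 2*pi * real k + 2*pi * real N * of_int (n div int N) = phase t"
    unfolding n rn by (simp add: algebra_simps)
  then have "t = phase_inv (s + 2*pi * real k) + 2*pi * of_int (n div int N)"
    by (metis phase_inv_period phase_inv_phase)
  then have "w = cis (phase_inv (s + 2*pi * real k))"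
    unfolding t using cis_eq_cis_iff by blast
  then show "w \<in> (\<lambda>k. cis (phase_inv (s + 2*pi * real k))) ` {..<N}" using k by blast
next
  fix w assume "w \<in> (\<lambda>k. cis (phase_inv (s + 2*pi * real k))) ` {..<N}"
  then show "w \<in> {w. b w = cis s}" by (auto simp: blaschke_cis cis_mult[symmetric])
qed

lemma inj_on_fiber_cis: "inj_on (\<lambda>k. cis (phase_inv (s + 2*pi * real k))) {..<N}"
proof (rule inj_onI)
  fix k l assume kl: "k \<in> {..<N}" "l \<in> {..<N}"
    and "cis (phase_inv (s + 2*pi * real k)) = cis (phase_inv (s + 2*pi * real l))"
  then obtain n where "phase_inv (s + 2*pi * real k) = phase_inv (s + 2*pi * real l) + 2*pi * of_int n"
    using cis_eq_cis_iff by blast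
  then have "s + 2*pi * real k = s + 2*pi * real l + 2*pi * real N * of_int n"
    by (metis phase_period phase_phase_inv)
  then have "2*pi * real k = 2*pi * (real l + real N * of_int n)" by (simp add: algebra_simps)
  then have "real k = real l + real N * of_int n" by simp
  then have "real_of_int (int k) = real_of_int (int l + int N * n)" by simp
  then have "int k = int l + int N * n" by (simp only: of_int_eq_iff)
  then have "int k mod int N = int l mod int N" by simp
  then show "k = l" using kl by simp
qed

text \<open>Borel branches of the inverse of b, taken at the principal argument of z. Every value
  lies on the circle, also for z off it. The jump of the argument across the cut only permutes the
  branches.\<close>

definition preim :: "nat \<Rightarrow> complex \<Rightarrow> complex" where
  "preim k z = cis (phase_inv (Im (Ln z) + 2*pi * real k))"

lemma measurable_preim [measurable]: "preim k \<in> borel_measurable borel"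
  unfolding preim_def[abs_def] by measurable

lemma cis_Im_Ln: "cmod z = 1 \<Longrightarrow> cis (Im (Ln z)) = z"
  by (metis Arg_eq_Im_Ln cis_Arg norm_zero sgn_div_norm scaleR_one inverse_1 zero_neq_one)

lemma fiber_eq: "cmod z = 1 \<Longrightarrow> {w. b w = z} = (\<lambda>k. preim k z) ` {..<N}"
  using fiber_cis[of "Im (Ln z)"] by (simp add: preim_def cis_Im_Ln)

lemma inj_on_preim: "inj_on (\<lambda>k. preim k z) {..<N}"
  unfolding preim_def by (rule inj_on_fiber_cis)

lemma sum_fiber: "cmod z = 1 \<Longrightarrow> (\<Sum>w\<in>{w. b w = z}. f w) = (\<Sum>k<N. f (preim k z))"
  by (simp add: fiber_eq sum.reindex[OF inj_on_preim])

text \<open>Replacing s by another argument of the same point permutes the fibre. Hence the sum is 2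
  pi periodic in s, which a single branch need not be.\<close>

lemma sum_preim_cis: "(\<Sum>k<N. f (preim k (cis s))) = (\<Sum>k<N. f (cis (phase_inv (s + 2*pi * real k))))"
proof -
  have "(\<Sum>k<N. f (preim k (cis s))) = (\<Sum>w\<in>{w. b w = cis s}. f w)" by (simp add: sum_fiber)
  also have "\<dots> = (\<Sum>k<N. f (cis (phase_inv (s + 2*pi * real k))))"
    by (simp add: fiber_cis sum.reindex[OF inj_on_fiber_cis])
  finally show ?thesis .
qed

lemma blaschke_preim: "cmod z = 1 \<Longrightarrow> k < N \<Longrightarrow> b (preim k z) = z"
  using fiber_eq[of z] by blast

section \<open>Change of variables along the fibres\<close>

text \<open>Under s = phase t one turn of the circle becomes an interval of length 2 pi N. It is cut
  into N intervals of length 2 pi, and translating each of them back onto the first yields one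
  branch of the inverse.\<close>

lemma nn_integral_poisson_sum:
  assumes [measurable]: "g \<in> borel_measurable borel"
  shows "(\<integral>\<^sup>+z. g z * ennreal (poisson_sum z) \<partial>circle_measure)
    = (\<integral>\<^sup>+z. (\<Sum>k<N. g (preim k z)) \<partial>circle_measure)"
proof -
  let ?h = "\<lambda>s. g (cis (phase_inv s))"
  let ?H = "\<lambda>s. \<Sum>k<N. ?h (s + 2*pi * real k)"
  define a where "a = phase 0"
  have ph: "phase (2*pi) = a + 2*pi * real N" using phase_period[of 0 1] by (simp add: a_def)
  have pN: "?h (s + 2*pi * real N) = ?h s" for s
    using phase_inv_period[of s 1] cis_eq_cis_iff[of "phase_inv (s + 2*pi * real N)" "phase_inv s"]
    by (metis mult.right_neutral of_int_1)
  have "(\<integral>\<^sup>+t. g (cis t) * ennreal (poisson_sum (cis t)) * indicator {0..2*pi} t \<partial>lborel)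
    = (\<integral>\<^sup>+t. ?h (phase t) * ennreal (poisson_sum (cis t)) * indicator {0..2*pi} t \<partial>lborel)"
    by simp
  also have "\<dots> = (\<integral>\<^sup>+s. ?h s * indicator {phase 0..phase (2*pi)} s \<partial>lborel)"
    by (rule nn_integral_substitution_aux[symmetric])
       (auto intro!: phase_has_derivative continuous_on_subset[OF continuous_on_poisson_sum]
          less_imp_le[OF poisson_sum_pos])
  also have "\<dots> = (\<integral>\<^sup>+s. ?h s * indicator {a..a + 2*pi * real N} s \<partial>lborel)"
    unfolding ph a_def ..
  \<comment> \<open>The number n of windows is separated from the N of the lift, so that induction
    on it is possible.\<close>
  also have "(\<integral>\<^sup>+s. ?h s * indicator {a..a + 2*pi * real n} s \<partial>lborel)
    = (\<integral>\<^sup>+s. (\<Sum>k<n. ?h (s + 2*pi * real k)) * indicator {a..a + 2*pi} s \<partial>lborel)" for n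
  proof (induction n)
    case 0
    have "(\<integral>\<^sup>+s. ?h s * indicator {a} s \<partial>lborel) = (\<integral>\<^sup>+(s::real). 0 \<partial>lborel)"
    proof (rule nn_integral_cong_AE)
      show "AE s in lborel. ?h s * indicator {a} s = 0"
        using AE_lborel_singleton[of a] by eventually_elim (auto simp: indicator_def)
    qed
    then show ?case by simp
  next
    case (Suc n)
    let ?c = "a + 2*pi * real n"
    have "(\<integral>\<^sup>+s. ?h s * indicator {a..a + 2*pi * real (Suc n)} s \<partial>lborel)
      = (\<integral>\<^sup>+s. ?h s * indicator {a..?c} s + ?h s * indicator {?c..?c + 2*pi} s \<partial>lborel)"
    proof (rule nn_integral_cong_AE)
      have "0 \<le> 2*pi * real n" by simp
      then have c: "a \<le> ?c" by linarith
      have e: "a + 2*pi * real (Suc n) = ?c + 2*pi" by (simp add: algebra_simps)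
      have aux: "f * indicator {a..c + 2*pi} s = f * indicator {a..c} s + f * indicator {c..c + 2*pi} s"
        if "a \<le> c" "s \<noteq> c" for f :: ennreal and c s
        using that pi_gt_zero by (auto simp: indicator_def simp del: pi_gt_zero)
      show "AE s in lborel. ?h s * indicator {a..a + 2*pi * real (Suc n)} s
          = ?h s * indicator {a..?c} s + ?h s * indicator {?c..?c + 2*pi} s"
        using AE_lborel_singleton[of ?c]
        unfolding e by eventually_elim (rule aux[OF c])
    qed
    also have "\<dots> = (\<integral>\<^sup>+s. ?h s * indicator {a..?c} s \<partial>lborel) + (\<integral>\<^sup>+s. ?h s * indicator {?c..?c + 2*pi} s \<partial>lborel)"
      by (rule nn_integral_add) auto
    also have "(\<integral>\<^sup>+s. ?h s * indicator {?c..?c + 2*pi} s \<partial>lborel)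
      = (\<integral>\<^sup>+s. ?h (s + 2*pi * real n) * indicator {a..a + 2*pi} s \<partial>lborel)"
      by (subst nn_integral_real_affine[where c=1 and t="2*pi * real n"])
         (auto intro!: nn_integral_cong simp: indicator_def add.commute[of "2*pi * real n"])
    also have "(\<integral>\<^sup>+s. ?h s * indicator {a..?c} s \<partial>lborel) + \<dots>
      = (\<integral>\<^sup>+s. (\<Sum>k<Suc n. ?h (s + 2*pi * real k)) * indicator {a..a + 2*pi} s \<partial>lborel)"
      unfolding Suc by (subst nn_integral_add[symmetric]) (auto simp: distrib_right)
    finally show ?case .
  qed
  \<comment> \<open>Moving the window from \<open>phase 0\<close> to 0 needs periodicity, which the
    sum over all branches has.\<close>
  also have "(\<integral>\<^sup>+s. ?H s * indicator {a..a + 2*pi} s \<partial>lborel) = (\<integral>\<^sup>+s. ?H s * indicator {0..2*pi} s \<partial>lborel)"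
  proof (rule nn_integral_period_interval)
    fix s
    show "?H (s + 2*pi) = ?H s"
      unfolding sum_preim_cis[symmetric] by (simp add: cis_mult[symmetric])
  qed auto
  also have "\<dots> = (\<integral>\<^sup>+s. (\<Sum>k<N. g (preim k (cis s))) * indicator {0..2*pi} s \<partial>lborel)"
    unfolding sum_preim_cis ..
  finally show ?thesis by (simp add: nn_integral_circle_measure)
qed

section \<open>The weight J_0 on the circle\<close>

lemma blaschke_differentiable:
  assumes "cmod z \<le> 1" shows "b field_differentiable (at z)"
proof -
  have "(\<lambda>z. \<Prod>j<n. blaschke_factor (\<alpha> j) z) field_differentiable (at z)" if "n \<le> N" for n
    using that
  proof (induction n)
    case (Suc n)
    then show ?case using zeros assms
      by (simp add: lessThan_Suc field_differentiable_mult blaschke_factor_differentiable)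
  qed simp
  then show ?thesis by (simp add: blaschke_def[abs_def])
qed

text \<open>Differentiating b(cis t) = cis(phase t) in two ways gives z b'(z) = b(z) phase'(t). In
  particular J_0 is real and positive on the circle.\<close>

lemma J0_eq_poisson_sum:
  assumes "cmod z = 1" shows "J0 N \<alpha> z = of_real (poisson_sum z / real N)"
proof -
  obtain t where t: "z = cis t" using assms by (rule cmod_eq_1_cis)
  have "(b has_field_derivative deriv b z) (at z)"
    using blaschke_differentiable[of z] assms field_differentiable_derivI by simp
  moreover have "(cis has_vector_derivative \<i> * z) (at t)"
    unfolding has_vector_derivative_def t
    by (auto intro!: derivative_eq_intros simp: scaleR_conv_of_real algebra_simps)
  ultimately have d1: "((b \<circ> cis) has_vector_derivative \<i> * z * deriv b z) (at t)"
    unfolding t by (intro field_vector_diff_chain_at)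
  have "((\<lambda>t. cis (phase t)) has_vector_derivative \<i> * b z * poisson_sum z) (at t)"
    unfolding has_vector_derivative_def t
    by (auto intro!: derivative_eq_intros phase_has_derivative[THEN has_field_derivative_imp_has_derivative]
         simp: scaleR_conv_of_real algebra_simps blaschke_cis)
  moreover have "(b \<circ> cis) = (\<lambda>t. cis (phase t))" by (auto simp: blaschke_cis)
  ultimately have "\<i> * z * deriv b z = \<i> * b z * poisson_sum z"
    using d1 vector_derivative_unique_at by metis
  then have "z * deriv b z = b z * poisson_sum z" by simp
  moreover have "b z \<noteq> 0" using cmod_blaschke_eq_1_iff[of z] assms by auto
  ultimately show ?thesis unfolding J0_def by simp
qed

end

section \<open>Radial limits of the Herglotz integral\<close>

text \<open>With v = z cis(-t) the kernel is (1+v)/(1-v), and \<open>F\<close> is an explicit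
  primitive. Its logarithmic part is periodic, so the increment over one turn is exactly 2
  pi.\<close>

lemma has_bochner_integral_herglotz_kernel:
  assumes z: "cmod z < 1"
  shows "has_bochner_integral circle_measure (\<lambda>\<zeta>. (\<zeta> + z) / (\<zeta> - z)) 1"
proof -
  define F where "F t = of_real t - 2 * \<i> * Ln (1 - z * cis (- t))" for t
  have d: "(F has_vector_derivative (cis t + z) / (cis t - z)) (at t)" for t
  proof -
    define v where "v = z * cis (- t)"
    have v: "cmod v < 1" using z by (simp add: v_def norm_mult)
    then have v1: "1 - v \<noteq> 0" by auto
    have "((\<lambda>t. 1 - z * cis (- t)) has_vector_derivative \<i> * v) (at t)"
      unfolding v_def has_vector_derivative_def
      by (auto intro!: derivative_eq_intros simp: scaleR_conv_of_real algebra_simps)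
    then have L: "((\<lambda>t. Ln (1 - z * cis (- t))) has_vector_derivative \<i> * v * inverse (1 - v)) (at t)"
      using field_vector_diff_chain_at[of "\<lambda>t. 1 - z * cis (- t)" "\<i> * v" t Ln "inverse (1 - v)"]
        one_minus_nonneg_Reals[OF v]
      by (simp add: o_def v_def has_field_derivative_Ln)
    have "(F has_vector_derivative 1 - 2 * \<i> * (\<i> * v * inverse (1 - v))) (at t)"
      unfolding F_def[abs_def] using has_vector_derivative_of_real[OF DERIV_ident, of "at t"]
      by (intro has_vector_derivative_diff has_vector_derivative_mult_right L) simp
    moreover have "1 - 2 * \<i> * (\<i> * v * inverse (1 - v)) = (1 + v) / (1 - v)"
      using v1 by (simp add: field_simps)
    moreover have "(cis t + z) / (cis t - z) = (cis t * (1 + v)) / (cis t * (1 - v))"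
      by (simp add: v_def algebra_simps cis_mult)
    ultimately show ?thesis by simp
  qed
  have "has_bochner_integral circle_measure (\<lambda>\<zeta>. (\<zeta> + z) / (\<zeta> - z)) ((F (2*pi) - F 0) / (2*pi))"
  proof (rule has_bochner_integral_circle_measure[OF _ d])
    have "cis t - z \<noteq> 0" for t using z by (metis norm_cis less_irrefl right_minus_eq)
    then show "continuous_on UNIV (\<lambda>t. (cis t + z) / (cis t - z))"
      by (intro continuous_intros continuous_on_cis) auto
  qed measurable
  also have "(F (2*pi) - F 0) / (2*pi) = 1"
    by (simp add: F_def flip: cis_inverse)
  finally show ?thesis .
qed

lemma measurable_herglotz:
  assumes [measurable]: "u \<in> borel_measurable borel"
  shows "herglotz u \<in> borel_measurable borel"
proof -
  have "(\<lambda>z. \<integral>\<zeta>. (\<zeta> + z) / (\<zeta> - z) * of_real (u \<zeta>) \<partial>circle_measure) \<in> borel_measurable borel"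
    by (intro circle.borel_measurable_lebesgue_integral) measurable
  then show ?thesis by (simp add: herglotz_def[abs_def])
qed

text \<open>This keeps a Lipschitz bound effective up to the boundary: the distance to e is
  controlled by the denominator of the kernel, uniformly in the radius. The point is that 1 - r is
  itself at most |zeta - r e|.\<close>

lemma dist_le_two_dist_radius:
  fixes \<zeta> e :: complex
  assumes "cmod \<zeta> = 1" "cmod e = 1" "0 \<le> r" "r \<le> 1"
  shows "cmod (\<zeta> - e) \<le> 2 * cmod (\<zeta> - of_real r * e)"
proof -
  have "cmod (\<zeta> - e) \<le> cmod (\<zeta> - of_real r * e) + cmod (of_real r * e - e)"
    using norm_triangle_ineq[of "\<zeta> - of_real r * e" "of_real r * e - e"] by simp
  moreover have "cmod (of_real r * e - e) = 1 - r"
  proof -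
    have "of_real r * e - e = of_real (r - 1) * e" by (simp add: algebra_simps)
    then show ?thesis using assms by (simp only: norm_mult norm_of_real) simp
  qed
  moreover have "cmod \<zeta> - cmod (of_real r * e) \<le> cmod (\<zeta> - of_real r * e)" by (rule norm_triangle_ineq2)
  then have "1 - r \<le> cmod (\<zeta> - of_real r * e)" using assms by (simp add: norm_mult)
  ultimately show ?thesis by linarith
qed

text \<open>As the kernel has mean 1, the constant u(e) can be split off. The remaining factor
  u(zeta) - u(e) cancels the singularity by the Lipschitz bound, so dominated convergence gives the
  limit. At r = 1 the kernel is purely imaginary, which leaves the real part u(e).\<close>

lemma herglotz_tendsto_on_circle:
  assumes [measurable]: "u \<in> borel_measurable borel"
    and lip: "\<And>\<zeta> e. cmod \<zeta> = 1 \<Longrightarrow> cmod e = 1 \<Longrightarrow> \<bar>u \<zeta> - u e\<bar> \<le> K * cmod (\<zeta> - e)"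
    and e: "cmod e = 1"
  shows "\<exists>l. ((\<lambda>r. herglotz u (of_real r * e)) \<longlongrightarrow> l) (at_left 1) \<and> Re l = u e"
proof -
  let ?g = "\<lambda>\<zeta> z. (\<zeta> + z) / (\<zeta> - z) * of_real (u \<zeta> - u e)"
  let ?I = "\<integral>\<zeta>. ?g \<zeta> e \<partial>circle_measure"
  have K: "K \<ge> 0"
    using lip[of 1 "-1"] abs_ge_zero[of "u 1 - u (-1)"] by (simp add: zero_le_mult_iff)
  \<comment> \<open>The 4 is a product: one factor 2 bounds |zeta + r e|, the other compares |zeta -
    e| with |zeta - r e|.\<close>
  have bound: "AE \<zeta> in circle_measure. cmod (?g \<zeta> (of_real r * e)) \<le> 4 * K" if r: "0 \<le> r" "r \<le> 1" for r
    using AE_circle_measure_cmod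
  proof eventually_elim
    case (elim \<zeta>)
    let ?z = "of_real r * e"
    have n: "cmod (\<zeta> + ?z) \<le> 2"
      using norm_triangle_ineq[of \<zeta> ?z] elim e r by (simp add: norm_mult)
    have "\<bar>u \<zeta> - u e\<bar> \<le> K * (2 * cmod (\<zeta> - ?z))"
      using lip[OF elim e] dist_le_two_dist_radius[OF elim e r] K
      by (meson mult_left_mono order_trans)
    then have "cmod (\<zeta> + ?z) * \<bar>u \<zeta> - u e\<bar> \<le> 2 * (K * (2 * cmod (\<zeta> - ?z)))"
      using n by (intro mult_mono) auto
    then show ?case
      by (cases "\<zeta> - ?z = 0") (auto simp: norm_mult norm_divide divide_le_eq K mult_ac simp flip: of_real_diff)
  qed
  have eq: "herglotz u (of_real r * e) = u e + (\<integral>\<zeta>. ?g \<zeta> (of_real r * e) \<partial>circle_measure)"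
    if r: "0 \<le> r" "r < 1" for r
  proof -
    let ?z = "of_real r * e"
    have k: "has_bochner_integral circle_measure (\<lambda>\<zeta>. (\<zeta> + ?z) / (\<zeta> - ?z) * of_real (u e)) (1 * of_real (u e))"
      using r e by (intro has_bochner_integral_mult_left has_bochner_integral_herglotz_kernel)
        (auto simp: norm_mult)
    have "integrable circle_measure (\<lambda>\<zeta>. ?g \<zeta> ?z)"
      using bound[of r] r by (intro circle.integrable_const_bound) auto
    then have "has_bochner_integral circle_measure (\<lambda>\<zeta>. (\<zeta> + ?z) / (\<zeta> - ?z) * of_real (u e) + ?g \<zeta> ?z)
        (1 * of_real (u e) + (\<integral>\<zeta>. ?g \<zeta> ?z \<partial>circle_measure))"
      by (intro has_bochner_integral_add k has_bochner_integral_integrable)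
    moreover have "(\<zeta> + ?z) / (\<zeta> - ?z) * of_real (u e) + ?g \<zeta> ?z = (\<zeta> + ?z) / (\<zeta> - ?z) * of_real (u \<zeta>)" for \<zeta>
      by (simp add: ring_distribs)
    ultimately show ?thesis
      unfolding herglotz_def by (simp add: has_bochner_integral_integral_eq)
  qed
  have "((\<lambda>r. herglotz u (of_real r * e)) \<longlongrightarrow> u e + ?I) (at_left 1)"
  proof (rule tendsto_at_left_sequentially[of 0])
    fix X :: "nat \<Rightarrow> real"
    assume X: "\<And>n. X n < 1" "\<And>n. 0 < X n" "X \<longlonglongrightarrow> 1"
    have "(\<lambda>n. \<integral>\<zeta>. ?g \<zeta> (of_real (X n) * e) \<partial>circle_measure) \<longlonglongrightarrow> ?I"
    proof (rule integral_dominated_convergence[where w="\<lambda>_. 4 * K"])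
      show "AE \<zeta> in circle_measure. (\<lambda>n. ?g \<zeta> (of_real (X n) * e)) \<longlonglongrightarrow> ?g \<zeta> e"
      proof (rule AE_I2)
        fix \<zeta>
        show "(\<lambda>n. ?g \<zeta> (of_real (X n) * e)) \<longlonglongrightarrow> ?g \<zeta> e"
        \<comment> \<open>At zeta = e the factor u(zeta) - u(e) vanishes, so all terms are
          0.\<close>
        proof (cases "\<zeta> = e")
          case False
          have "(\<lambda>n. of_real (X n) * e) \<longlonglongrightarrow> of_real 1 * e" using X by (intro tendsto_intros)
          then show ?thesis using False by (auto intro!: tendsto_intros)
        qed simp
      qed
      show "AE \<zeta> in circle_measure. cmod (?g \<zeta> (of_real (X n) * e)) \<le> 4 * K" for n
        using X by (intro bound) (auto simp: less_imp_le)
    qed auto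
    then have "(\<lambda>n. u e + (\<integral>\<zeta>. ?g \<zeta> (of_real (X n) * e) \<partial>circle_measure)) \<longlonglongrightarrow> u e + ?I"
      by (intro tendsto_intros)
    then show "(\<lambda>n. herglotz u (of_real (X n) * e)) \<longlonglongrightarrow> u e + ?I"
      using X by (subst eq) (auto simp: less_imp_le)
  qed simp
  moreover have "Re ?I = 0"
  proof -
    have int: "integrable circle_measure (\<lambda>\<zeta>. ?g \<zeta> e)"
      using bound[of 1] by (intro circle.integrable_const_bound[where B="4 * K"]) auto
    have "Re ?I = (\<integral>\<zeta>. Re (?g \<zeta> e) \<partial>circle_measure)"
      using int by simp
    also have "\<dots> = (\<integral>\<zeta>. 0 \<partial>circle_measure)"
    proof (rule integral_cong_AE)
      show "AE \<zeta> in circle_measure. Re (?g \<zeta> e) = 0"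
        using AE_circle_measure_cmod
      proof eventually_elim
        case (elim \<zeta>)
        have "(cmod \<zeta>)\<^sup>2 = (cmod e)\<^sup>2" using elim e by simp
        then have "Re ((\<zeta> + e) * cnj (\<zeta> - e)) = 0"
          unfolding cmod_power2 by (simp add: algebra_simps power2_eq_square)
        then have "Re ((\<zeta> + e) / (\<zeta> - e)) = 0"
          by (subst complex_div_cnj) (simp flip: of_real_power)
        then show ?case by (simp only: Re_complex_of_real Im_complex_of_real times_complex.simps(1) mult_zero_left mult_zero_right diff_zero)
      qed
    qed auto
    finally show ?thesis by simp
  qed
  ultimately show ?thesis by (intro exI[of _ "u e + ?I"]) auto
qed

text \<open>Serves the measurability of \<open>J_sqrt_bd\<close>, which is a limit at every point of
  the plane. Near r = 1 the path r e keeps away from the circle, so the kernel is bounded.\<close>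

lemma herglotz_tendsto_off_circle:
  assumes [measurable]: "u \<in> borel_measurable borel"
    and bd: "\<And>\<zeta>. cmod \<zeta> = 1 \<Longrightarrow> \<bar>u \<zeta>\<bar> \<le> B"
    and e: "cmod e \<noteq> 1"
  shows "((\<lambda>r. herglotz u (of_real r * e)) \<longlongrightarrow> herglotz u e) (at_left 1)"
proof -
  define d where "d = \<bar>1 - cmod e\<bar> / 2"
  have d: "d > 0" using e by (simp add: d_def)
  \<comment> \<open>For r above \<open>c\<close> the point r e has moved by at most
    \<open>d\<close>, half the distance of e from the circle, so it stays at distance at least
    \<open>d\<close> from the circle.\<close>
  define c where "c = max 0 (1 - d / (cmod e + 1))"
  have ne: "cmod e + 1 > 0" by (simp add: add_nonneg_pos)
  have c: "c < 1" using d ne by (auto simp: c_def)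
  have B: "B \<ge> 0" using bd[of 1] by simp
  show ?thesis
  proof (rule tendsto_at_left_sequentially[OF c])
    fix X :: "nat \<Rightarrow> real"
    assume X: "\<And>n. X n < 1" "\<And>n. c < X n" "X \<longlonglongrightarrow> 1"
    let ?g = "\<lambda>\<zeta> z. (\<zeta> + z) / (\<zeta> - z) * of_real (u \<zeta>)"
    have "(\<lambda>n. \<integral>\<zeta>. ?g \<zeta> (of_real (X n) * e) \<partial>circle_measure) \<longlonglongrightarrow> (\<integral>\<zeta>. ?g \<zeta> e \<partial>circle_measure)"
    proof (rule integral_dominated_convergence[where w="\<lambda>_. (1 + cmod e) / d * B"])
      show "AE \<zeta> in circle_measure. (\<lambda>n. ?g \<zeta> (of_real (X n) * e)) \<longlonglongrightarrow> ?g \<zeta> e"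
        using AE_circle_measure_cmod
      proof eventually_elim
        case (elim \<zeta>)
        then have "\<zeta> \<noteq> e" using e by auto
        moreover have "(\<lambda>n. of_real (X n) * e) \<longlonglongrightarrow> of_real 1 * e" using X by (intro tendsto_intros)
        ultimately show ?case by (auto intro!: tendsto_intros)
      qed
      show "AE \<zeta> in circle_measure. cmod (?g \<zeta> (of_real (X n) * e)) \<le> (1 + cmod e) / d * B" for n
        using AE_circle_measure_cmod
      proof eventually_elim
        case (elim \<zeta>)
        let ?z = "of_real (X n) * e"
        have Xn: "0 \<le> X n" "X n \<le> 1" "1 - d / (cmod e + 1) \<le> X n"
          using X(1,2)[of n] by (auto simp: c_def)
        have "(1 - X n) * (cmod e + 1) \<le> d" using Xn(3) ne by (simp add: field_simps)
        then have "cmod e - X n * cmod e \<le> d" using Xn by (simp add: algebra_simps)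
        moreover have le: "X n * cmod e \<le> 1 * cmod e" using Xn by (intro mult_right_mono) auto
        moreover have "2 * d = \<bar>1 - cmod e\<bar>" by (simp add: d_def)
        ultimately have "d \<le> \<bar>1 - X n * cmod e\<bar>" by linarith
        also have "\<dots> = \<bar>cmod \<zeta> - cmod ?z\<bar>" using elim Xn by (simp add: norm_mult)
        also have "\<dots> \<le> cmod (\<zeta> - ?z)" by (rule norm_triangle_ineq3)
        finally have 1: "d \<le> cmod (\<zeta> - ?z)" .
        have "cmod (\<zeta> + ?z) \<le> 1 + cmod e"
          using le norm_triangle_ineq[of \<zeta> ?z] elim Xn by (simp add: norm_mult)
        then have "cmod (\<zeta> + ?z) / cmod (\<zeta> - ?z) \<le> (1 + cmod e) / d"
          using 1 d by (intro frac_le) auto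
        then have "cmod (\<zeta> + ?z) / cmod (\<zeta> - ?z) * \<bar>u \<zeta>\<bar> \<le> (1 + cmod e) / d * B"
          using bd[OF elim] d by (intro mult_mono) auto
        then show ?case by (simp add: norm_mult norm_divide)
      qed
    qed auto
    then show "(\<lambda>n. herglotz u (of_real (X n) * e)) \<longlonglongrightarrow> herglotz u e"
      by (simp add: herglotz_def)
  qed
qed

section \<open>Regularity of log J_0 and boundary values of the outer square root\<close>

context blaschke_product begin

text \<open>Each term is c x^2 with x = 1 / |z - a| at most R = 1 / (1 - |a|), where a is the zero
  in question. The reciprocal contributes a Lipschitz constant R^2 and the square 2 R, whence 2
  R^3.\<close>

lemma poisson_sum_lipschitz:
  "\<exists>K. \<forall>\<zeta> e. cmod \<zeta> = 1 \<longrightarrow> cmod e = 1 \<longrightarrow> \<bar>poisson_sum \<zeta> - poisson_sum e\<bar> \<le> K * cmod (\<zeta> - e)"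
proof -
  define c where "c j = 1 - (cmod (\<alpha> j))\<^sup>2" for j
  define R where "R j = 1 / (1 - cmod (\<alpha> j))" for j
  have j: "\<bar>c j / (cmod (\<zeta> - \<alpha> j))\<^sup>2 - c j / (cmod (e - \<alpha> j))\<^sup>2\<bar> \<le> \<bar>c j\<bar> * (2 * R j ^ 3) * cmod (\<zeta> - e)"
    if "j < N" "cmod \<zeta> = 1" "cmod e = 1" for j \<zeta> e
  proof -
    have a: "cmod (\<alpha> j) < 1" using that zeros by simp
    define x y where "x = 1 / cmod (\<zeta> - \<alpha> j)" and "y = 1 / cmod (e - \<alpha> j)"
    have p: "1 - cmod (\<alpha> j) \<le> cmod (\<zeta> - \<alpha> j)" "1 - cmod (\<alpha> j) \<le> cmod (e - \<alpha> j)"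
      using norm_triangle_ineq2[of \<zeta> "\<alpha> j"] norm_triangle_ineq2[of e "\<alpha> j"] that by auto
    have q: "cmod (\<zeta> - \<alpha> j) > 0" "cmod (e - \<alpha> j) > 0" using p a by linarith+
    have R: "0 \<le> x" "x \<le> R j" "0 \<le> y" "y \<le> R j"
      using p a unfolding x_def y_def R_def by (auto intro!: divide_left_mono mult_pos_pos q)
    have "\<bar>x - y\<bar> = \<bar>cmod (e - \<alpha> j) - cmod (\<zeta> - \<alpha> j)\<bar> * (x * y)"
    proof -
      have "x - y = (cmod (e - \<alpha> j) - cmod (\<zeta> - \<alpha> j)) * (x * y)"
        using q unfolding x_def y_def by (simp add: field_simps)
      then show ?thesis using R by (simp add: abs_mult)
    qed
    also have "\<dots> \<le> cmod (\<zeta> - e) * (R j * R j)"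
      using norm_triangle_ineq3[of "e - \<alpha> j" "\<zeta> - \<alpha> j"] R
      by (intro mult_mono) (auto simp: norm_minus_commute)
    finally have 1: "\<bar>x - y\<bar> \<le> cmod (\<zeta> - e) * (R j * R j)" .
    have "\<bar>x\<^sup>2 - y\<^sup>2\<bar> = \<bar>x - y\<bar> * (x + y)"
      using R by (simp add: power2_eq_square square_diff_square_factored abs_mult)
    also have "\<dots> \<le> (cmod (\<zeta> - e) * (R j * R j)) * (2 * R j)"
      using 1 R by (intro mult_mono) auto
    finally have "\<bar>c j\<bar> * \<bar>x\<^sup>2 - y\<^sup>2\<bar> \<le> \<bar>c j\<bar> * ((cmod (\<zeta> - e) * (R j * R j)) * (2 * R j))"
      by (intro mult_left_mono) auto
    also have "\<bar>c j\<bar> * \<bar>x\<^sup>2 - y\<^sup>2\<bar> = \<bar>c j / (cmod (\<zeta> - \<alpha> j))\<^sup>2 - c j / (cmod (e - \<alpha> j))\<^sup>2\<bar>"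
      unfolding abs_mult[symmetric] x_def y_def by (simp add: power_divide right_diff_distrib)
    finally show ?thesis by (simp add: power3_eq_cube mult_ac)
  qed
  have "\<bar>poisson_sum \<zeta> - poisson_sum e\<bar> \<le> (\<Sum>j<N. \<bar>c j\<bar> * (2 * R j ^ 3)) * cmod (\<zeta> - e)"
    if "cmod \<zeta> = 1" "cmod e = 1" for \<zeta> e
    unfolding poisson_sum_def sum_subtractf[symmetric] sum_distrib_right
    using that j by (intro order_trans[OF sum_abs] sum_mono) (auto simp: c_def)
  then show ?thesis by blast
qed

lemma continuous_on_sphere_poisson_sum: "continuous_on (sphere 0 1) poisson_sum"
  unfolding poisson_sum_def[abs_def]
proof (intro continuous_intros ballI)
  fix j and z :: complex assume "j \<in> {..<N}" "z \<in> sphere 0 1"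
  then have "cmod (\<alpha> j) < 1" "cmod z = 1" using zeros by auto
  then show "(cmod (z - \<alpha> j))\<^sup>2 \<noteq> 0" by auto
qed

lemma poisson_sum_lower_bound: "\<exists>c>0. \<forall>z. cmod z = 1 \<longrightarrow> c \<le> poisson_sum z"
proof -
  have "(1::complex) \<in> sphere 0 1" by simp
  then obtain x where "x \<in> sphere 0 1" "\<forall>y\<in>sphere 0 1. poisson_sum x \<le> poisson_sum y"
    using continuous_attains_inf[OF compact_sphere _ continuous_on_sphere_poisson_sum] by blast
  then show ?thesis using poisson_sum_pos[of x] by (intro exI[of _ "poisson_sum x"]) auto
qed

text \<open>\<open>J0\<close> contains \<open>deriv\<close>, so measurability comes from holomorphy
  off the finite set \<open>X\<close>, which contains the poles and zeros of b; changing a Borel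
  function on a finite set keeps it Borel.\<close>

lemma measurable_J0 [measurable]: "J0 N \<alpha> \<in> borel_measurable borel"
proof -
  define X where "X = (\<lambda>j. 1 / cnj (\<alpha> j)) ` {..<N} \<union> {z. b z = 0}"
  \<comment> \<open>With division by zero, b also vanishes at its poles.\<close>
  have bz: "{z. b z = 0} \<subseteq> \<alpha> ` {..<N} \<union> (\<lambda>j. 1 / cnj (\<alpha> j)) ` {..<N} \<union> {0}"
  proof
    fix z assume "z \<in> {z. b z = 0}"
    then obtain j where j: "j < N" "blaschke_factor (\<alpha> j) z = 0"
      by (auto simp: blaschke_def prod_zero_iff)
    then have "z = \<alpha> j \<or> z = 1 / cnj (\<alpha> j) \<or> z = 0"
      by (auto simp: blaschke_factor_def field_simps split: if_splits)
    then show "z \<in> \<alpha> ` {..<N} \<union> (\<lambda>j. 1 / cnj (\<alpha> j)) ` {..<N} \<union> {0}" using j by auto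
  qed
  then have "finite {z. b z = 0}" by (rule finite_subset) simp
  then have fin: "finite X" by (simp add: X_def)
  have nz: "1 - cnj (\<alpha> j) * z \<noteq> 0" if "z \<in> - X" "j < N" for z j
  proof
    assume *: "1 - cnj (\<alpha> j) * z = 0"
    then have "\<alpha> j \<noteq> 0" by auto
    then have "z = 1 / cnj (\<alpha> j)" using * by (simp add: field_simps)
    then show False using that by (auto simp: X_def)
  qed
  have op: "open (- X)" using fin by (simp add: finite_imp_closed open_Compl)
  have "blaschke_factor (\<alpha> j) holomorphic_on (- X)" if "j < N" for j
  proof (cases "\<alpha> j = 0")
    case False
    then show ?thesis unfolding blaschke_factor_def[abs_def]
      using nz that by (auto intro!: holomorphic_intros)
  qed (simp add: blaschke_factor_def[abs_def])
  then have hol: "b holomorphic_on (- X)"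
    unfolding blaschke_def[abs_def] by (intro holomorphic_intros) auto
  have "J0 N \<alpha> holomorphic_on (- X)"
    unfolding J0_def[abs_def] using hol op N_pos
    by (intro holomorphic_intros) (auto simp: X_def)
  then have "(\<lambda>z. indicator (- X) z *\<^sub>R J0 N \<alpha> z) \<in> borel_measurable borel"
    using op by (intro borel_measurable_continuous_on_indicator holomorphic_on_imp_continuous_on) auto
  then show ?thesis
    by (rule measurable_discrete_difference[where X=X]) (use fin in \<open>auto intro: countable_finite\<close>)
qed

definition log_J0 :: "complex \<Rightarrow> real" where "log_J0 \<zeta> = ln (cmod (J0 N \<alpha> \<zeta>))"

lemma measurable_log_J0 [measurable]: "log_J0 \<in> borel_measurable borel"
  unfolding log_J0_def[abs_def] by measurable

lemma log_J0_eq: "cmod z = 1 \<Longrightarrow> log_J0 z = ln (poisson_sum z / N)"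
  using poisson_sum_pos[of z] by (simp add: log_J0_def J0_eq_poisson_sum norm_divide)

text \<open>The tangent inequality ln x - ln y \<le> (x - y) / y, together with the positive lower
  bound of \<open>poisson_sum\<close> on the circle, gives one side; exchanging the two points gives
  the other.\<close>

lemma log_J0_lipschitz:
  "\<exists>K. \<forall>\<zeta> e. cmod \<zeta> = 1 \<longrightarrow> cmod e = 1 \<longrightarrow> \<bar>log_J0 \<zeta> - log_J0 e\<bar> \<le> K * cmod (\<zeta> - e)"
proof -
  obtain K where K: "\<bar>poisson_sum \<zeta> - poisson_sum e\<bar> \<le> K * cmod (\<zeta> - e)"
    if "cmod \<zeta> = 1" "cmod e = 1" for \<zeta> e using poisson_sum_lipschitz by blast
  obtain c where c: "c > 0" "\<And>z. cmod z = 1 \<Longrightarrow> c \<le> poisson_sum z"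
    using poisson_sum_lower_bound by blast
  have h: "log_J0 \<zeta> - log_J0 e \<le> K / c * cmod (\<zeta> - e)" if "cmod \<zeta> = 1" "cmod e = 1" for \<zeta> e
  proof -
    have pos: "poisson_sum \<zeta> > 0" "poisson_sum e > 0" using that poisson_sum_pos by auto
    have "log_J0 \<zeta> - log_J0 e = ln (poisson_sum \<zeta>) - ln (poisson_sum e)"
      using that pos N_pos by (simp add: log_J0_eq ln_div)
    also have "\<dots> \<le> (poisson_sum \<zeta> - poisson_sum e) / poisson_sum e" using pos by (rule ln_diff_le)
    also have "\<dots> \<le> \<bar>poisson_sum \<zeta> - poisson_sum e\<bar> / poisson_sum e"
      using pos by (intro divide_right_mono) auto
    also have "\<dots> \<le> (K * cmod (\<zeta> - e)) / c"
      using K[OF that] c(1) c(2)[OF that(2)] by (intro frac_le) (auto intro: order_trans[OF abs_ge_zero])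
    finally show ?thesis by simp
  qed
  have "\<bar>log_J0 \<zeta> - log_J0 e\<bar> \<le> K / c * cmod (\<zeta> - e)" if "cmod \<zeta> = 1" "cmod e = 1" for \<zeta> e
    using h[OF that] h[OF that(2,1)] by (simp add: abs_le_iff norm_minus_commute)
  then show ?thesis by blast
qed

abbreviation k :: "complex \<Rightarrow> complex" where "k \<equiv> J_sqrt_bd N \<alpha>"

lemma J_sqrt_eq: "J_sqrt N \<alpha> z = exp (herglotz log_J0 z / 2)"
  by (simp add: J_sqrt_def log_J0_def[abs_def])

text \<open>The first claim covers every z, for the sake of measurability. On the circle the limit l
  of the Herglotz integral has real part log J_0(z), so |exp (l/2)|^2 = exp (Re l) = J_0(z).\<close>

lemma J_sqrt_tendsto_J_sqrt_bd:
  "((\<lambda>r. J_sqrt N \<alpha> (of_real r * z)) \<longlongrightarrow> k z) (at_left 1)"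
  and cmod_J_sqrt_bd: "cmod z = 1 \<Longrightarrow> (cmod (k z))\<^sup>2 = poisson_sum z / N"
proof -
  obtain K where K: "\<And>\<zeta> e. cmod \<zeta> = 1 \<Longrightarrow> cmod e = 1 \<Longrightarrow> \<bar>log_J0 \<zeta> - log_J0 e\<bar> \<le> K * cmod (\<zeta> - e)"
    using log_J0_lipschitz by blast
  have K0: "K \<ge> 0"
    using K[of 1 "-1"] abs_ge_zero[of "log_J0 1 - log_J0 (-1)"] by (simp add: zero_le_mult_iff)
  have bd: "\<bar>log_J0 \<zeta>\<bar> \<le> \<bar>log_J0 1\<bar> + 2 * K" if "cmod \<zeta> = 1" for \<zeta>
  proof -
    have "cmod (\<zeta> - 1) \<le> 2" using norm_triangle_ineq4[of \<zeta> 1] that by simp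
    then have "K * cmod (\<zeta> - 1) \<le> K * 2" using K0 by (rule mult_left_mono)
    then show ?thesis using K[of \<zeta> 1] that by simp
  qed
  have lim: "k z = exp (l / 2)" "((\<lambda>r. J_sqrt N \<alpha> (of_real r * z)) \<longlongrightarrow> k z) (at_left 1)"
    if "((\<lambda>r. herglotz log_J0 (of_real r * z)) \<longlongrightarrow> l) (at_left 1)" for l
  proof -
    have t: "((\<lambda>r. J_sqrt N \<alpha> (of_real r * z)) \<longlongrightarrow> exp (l / 2)) (at_left 1)"
      unfolding J_sqrt_eq using that by (intro tendsto_intros) auto
    then show 1: "k z = exp (l / 2)"
      unfolding J_sqrt_bd_def by (intro tendsto_Lim) auto
    show "((\<lambda>r. J_sqrt N \<alpha> (of_real r * z)) \<longlongrightarrow> k z) (at_left 1)" using t 1 by simp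
  qed
  show "((\<lambda>r. J_sqrt N \<alpha> (of_real r * z)) \<longlongrightarrow> k z) (at_left 1)"
  proof (cases "cmod z = 1")
    case True then show ?thesis
      using herglotz_tendsto_on_circle[OF measurable_log_J0 K] lim(2) by blast
  next
    case False then show ?thesis
      using herglotz_tendsto_off_circle[OF measurable_log_J0 bd] lim(2) by blast
  qed
  assume z: "cmod z = 1"
  obtain l where l: "((\<lambda>r. herglotz log_J0 (of_real r * z)) \<longlongrightarrow> l) (at_left 1)" "Re l = log_J0 z"
    using herglotz_tendsto_on_circle[OF measurable_log_J0 K z] by blast
  have "(cmod (k z))\<^sup>2 = exp (Re l)"
    unfolding lim(1)[OF l(1)] by (simp add: norm_exp_eq_Re flip: exp_double)
  also have "\<dots> = poisson_sum z / N"
    using z N_pos poisson_sum_pos[OF z] by (simp add: l log_J0_eq)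
  finally show "(cmod (k z))\<^sup>2 = poisson_sum z / N" .
qed

lemma J_sqrt_bd_nonzero: "cmod z = 1 \<Longrightarrow> k z \<noteq> 0"
  using cmod_J_sqrt_bd[of z] poisson_sum_pos[of z] N_pos by auto

lemma measurable_J_sqrt_bd [measurable]: "k \<in> borel_measurable borel"
proof (rule borel_measurable_LIMSEQ_metric)
  let ?r = "\<lambda>n. 1 - inverse (real (Suc n))"
  have h[measurable]: "herglotz log_J0 \<in> borel_measurable borel"
    by (rule measurable_herglotz) measurable
  show "(\<lambda>z. J_sqrt N \<alpha> (of_real (?r n) * z)) \<in> borel_measurable borel" for n
    unfolding J_sqrt_eq[abs_def] by measurable
  fix z
  have "filterlim ?r (at_left 1) sequentially"
    unfolding filterlim_at using LIMSEQ_inverse_real_of_nat_add_minus[of 1] by simp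
  then show "(\<lambda>n. J_sqrt N \<alpha> (of_real (?r n) * z)) \<longlonglongrightarrow> k z"
    by (rule filterlim_compose[OF J_sqrt_tendsto_J_sqrt_bd])
qed

end

section \<open>Operators on the square integrable functions\<close>

lemma measurable_circle_measure_eq [simp]: "measurable circle_measure M = measurable borel M"
  by (rule measurable_cong_sets) auto

lemma measurable_cnj [measurable]: "cnj \<in> borel_measurable borel"
  by (intro borel_measurable_continuous_onI continuous_intros)

text \<open>The squared L^2 norm with values in [0, \<infinity>]: bounds can be stated for all
  measurable functions, and membership in L^2 becomes finiteness.\<close>

definition nn_norm2 :: "(complex \<Rightarrow> complex) \<Rightarrow> ennreal" where
  "nn_norm2 f = (\<integral>\<^sup>+z. ennreal ((cmod (f z))\<^sup>2) \<partial>circle_measure)"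

lemma L2_iff: "L2 f \<longleftrightarrow> f \<in> borel_measurable borel \<and> nn_norm2 f < \<infinity>"
  unfolding L2_def nn_norm2_def by (auto simp: integrable_iff_bounded)

lemma L2_measurable: "L2 f \<Longrightarrow> f \<in> borel_measurable borel"
  by (simp add: L2_iff)

lemma Linf_measurable: "Linf f \<Longrightarrow> f \<in> borel_measurable borel"
  by (simp add: Linf_def)

lemma l2_norm_eq: "L2 f \<Longrightarrow> l2_norm f = sqrt (enn2real (nn_norm2 f))"
  unfolding l2_norm_def nn_norm2_def by (subst integral_eq_nn_integral) (auto simp: L2_iff)

lemma nn_norm2_cong_AE: "AE z in circle_measure. f z = g z \<Longrightarrow> nn_norm2 f = nn_norm2 g"
  unfolding nn_norm2_def by (intro nn_integral_cong_AE) auto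

lemma nn_norm2_mono_AE:
  assumes f: "f \<in> borel_measurable borel" and "AE z in circle_measure. cmod (g z) \<le> C * cmod (f z)"
  shows "nn_norm2 g \<le> ennreal (C\<^sup>2) * nn_norm2 f"
proof -
  note [measurable] = f
  have "nn_norm2 g \<le> (\<integral>\<^sup>+z. ennreal (C\<^sup>2) * ennreal ((cmod (f z))\<^sup>2) \<partial>circle_measure)"
    unfolding nn_norm2_def
  proof (rule nn_integral_mono_AE)
    show "AE z in circle_measure. ennreal ((cmod (g z))\<^sup>2) \<le> ennreal (C\<^sup>2) * ennreal ((cmod (f z))\<^sup>2)"
      using assms(2)
    proof eventually_elim
      case (elim z)
      then have "(cmod (g z))\<^sup>2 \<le> (C * cmod (f z))\<^sup>2" by (intro power_mono) auto
      then show ?case by (simp add: power_mult_distrib ennreal_leI flip: ennreal_mult)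
    qed
  qed
  also have "\<dots> = ennreal (C\<^sup>2) * nn_norm2 f"
    unfolding nn_norm2_def by (rule nn_integral_cmult) auto
  finally show ?thesis .
qed

lemma L2_bounded_mult:
  assumes f: "L2 f" and m: "Linf m" shows "L2 (\<lambda>z. m z * f z)"
proof -
  obtain C where "AE z in circle_measure. cmod (m z) \<le> C" using m by (auto simp: Linf_def)
  then have "AE z in circle_measure. cmod (m z * f z) \<le> C * cmod (f z)"
    by eventually_elim (auto simp: norm_mult intro: mult_right_mono)
  then have "nn_norm2 (\<lambda>z. m z * f z) \<le> ennreal (C\<^sup>2) * nn_norm2 f"
    by (rule nn_norm2_mono_AE[OF L2_measurable[OF f]])
  also have "\<dots> < \<infinity>" using f by (auto simp: L2_iff ennreal_mult_less_top)
  finally show ?thesis using f m by (auto simp: L2_iff Linf_def)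
qed

lemma Linf_imp_L2:
  assumes m: "Linf m" shows "L2 m"
proof -
  have "L2 (\<lambda>_. 1)" by (simp add: L2_def)
  then show ?thesis using L2_bounded_mult[OF _ m] by fastforce
qed

lemma L2_const: "L2 (\<lambda>_. c)" by (simp add: L2_def)

lemma L2_linear:
  assumes f: "L2 f" and g: "L2 g" shows "L2 (\<lambda>z. f z + c * g z)"
proof -
  note [measurable] = L2_measurable[OF f] L2_measurable[OF g]
  have "integrable circle_measure (\<lambda>z. (cmod (f z + c * g z))\<^sup>2)"
  proof (rule Bochner_Integration.integrable_bound)
    show "integrable circle_measure (\<lambda>z. 2 * (cmod (f z))\<^sup>2 + 2 * (cmod c)\<^sup>2 * (cmod (g z))\<^sup>2)"
      using f g by (auto simp: L2_def)
    show "AE z in circle_measure. norm ((cmod (f z + c * g z))\<^sup>2)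
      \<le> norm (2 * (cmod (f z))\<^sup>2 + 2 * (cmod c)\<^sup>2 * (cmod (g z))\<^sup>2)"
    proof (rule AE_I2)
      fix z
      have "(cmod (f z + c * g z))\<^sup>2 \<le> (cmod (f z) + cmod (c * g z))\<^sup>2"
        by (intro power_mono norm_triangle_ineq) auto
      also have "\<dots> \<le> 2 * (cmod (f z))\<^sup>2 + 2 * (cmod (c * g z))\<^sup>2"
        using sum_squares_bound[of "cmod (f z)" "cmod (c * g z)"] by (simp add: power2_sum)
      finally show "norm ((cmod (f z + c * g z))\<^sup>2) \<le> norm (2 * (cmod (f z))\<^sup>2 + 2 * (cmod c)\<^sup>2 * (cmod (g z))\<^sup>2)"
        by (simp add: norm_mult power_mult_distrib)
    qed
  qed measurable
  then show ?thesis by (simp add: L2_def)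
qed

lemma integrable_L2_mult:
  assumes f: "L2 f" and g: "L2 g" shows "integrable circle_measure (\<lambda>z. cnj (f z) * g z)"
proof (rule Bochner_Integration.integrable_bound)
  note [measurable] = L2_measurable[OF f] L2_measurable[OF g]
  show "integrable circle_measure (\<lambda>z. (cmod (f z))\<^sup>2 + (cmod (g z))\<^sup>2)"
    using f g by (auto simp: L2_def)
  show "(\<lambda>z. cnj (f z) * g z) \<in> borel_measurable circle_measure" by measurable
  show "AE z in circle_measure. norm (cnj (f z) * g z) \<le> norm ((cmod (f z))\<^sup>2 + (cmod (g z))\<^sup>2)"
  proof (rule AE_I2)
    fix z
    show "norm (cnj (f z) * g z) \<le> norm ((cmod (f z))\<^sup>2 + (cmod (g z))\<^sup>2)"
    proof -
      have "0 \<le> cmod (f z) * cmod (g z)" by simp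
      then have "cmod (f z) * cmod (g z) \<le> (cmod (f z))\<^sup>2 + (cmod (g z))\<^sup>2"
        using sum_squares_bound[of "cmod (f z)" "cmod (g z)"] by linarith
      then show ?thesis by (simp add: norm_mult)
    qed
  qed
qed

lemma l2_inner_self: "l2_inner f f = of_real (\<integral>z. (cmod (f z))\<^sup>2 \<partial>circle_measure)"
proof -
  have "cnj (f z) * f z = of_real ((cmod (f z))\<^sup>2)" for z
    by (metis complex_norm_square mult.commute of_real_power)
  then show ?thesis unfolding l2_inner_def by (simp only: integral_complex_of_real)
qed

section \<open>Bounded operators and uniqueness of adjoints\<close>

lemma bounded_op_L2: "bounded_op T \<Longrightarrow> L2 f \<Longrightarrow> L2 (T f)"
  by (simp add: bounded_op_def)

lemma bounded_op_cong:
  "bounded_op T \<Longrightarrow> L2 f \<Longrightarrow> L2 g \<Longrightarrow> AE z in circle_measure. f z = g z \<Longrightarrow>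
    AE z in circle_measure. T f z = T g z"
  by (simp add: bounded_op_def)

lemma bounded_op_zero:
  assumes "bounded_op T" shows "AE z in circle_measure. T (\<lambda>_. 0) z = 0"
proof -
  have "AE z in circle_measure. T (\<lambda>w. 0 + 1 * 0) z = T (\<lambda>_. 0) z + 1 * T (\<lambda>_. 0) z"
    using assms L2_const[of 0] unfolding bounded_op_def by blast
  then show ?thesis by simp
qed

lemma bounded_opI:
  assumes meas: "\<And>f. f \<in> borel_measurable borel \<Longrightarrow> T f \<in> borel_measurable borel"
    and le: "\<And>f. f \<in> borel_measurable borel \<Longrightarrow> nn_norm2 (T f) \<le> ennreal (C\<^sup>2) * nn_norm2 f"
    and cong: "\<And>f g. AE z in circle_measure. f z = g z \<Longrightarrow> AE z in circle_measure. T f z = T g z"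
    and lin: "\<And>f g c z. T (\<lambda>w. f w + c * g w) z = T f z + c * T g z"
  shows "bounded_op T"
proof -
  have L2: "L2 (T f)" if "L2 f" for f
    using that meas le[of f] unfolding L2_iff
    by (auto intro: le_less_trans simp: ennreal_mult_less_top)
  have "l2_norm (T f) \<le> \<bar>C\<bar> * l2_norm f" if f: "L2 f" for f
  proof -
    have "enn2real (nn_norm2 (T f)) \<le> enn2real (ennreal (C\<^sup>2) * nn_norm2 f)"
      using le[of f] f by (intro enn2real_mono) (auto simp: L2_iff ennreal_mult_less_top)
    then have "sqrt (enn2real (nn_norm2 (T f))) \<le> sqrt (C\<^sup>2 * enn2real (nn_norm2 f))"
      by (simp add: enn2real_mult)
    then show ?thesis using f L2 by (simp add: l2_norm_eq real_sqrt_mult)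
  qed
  then show ?thesis unfolding bounded_op_def using L2 cong by (auto simp: lin)
qed

lemma is_adjoint_op_adjoint: "is_adjoint T Ts \<Longrightarrow> is_adjoint T (op_adjoint T)"
  unfolding op_adjoint_def by (rule someI[of "is_adjoint T"])

text \<open>\<open>op_adjoint\<close> is only some adjoint; this is the passage from it to an
  explicit formula. Allowing two operators that agree almost everywhere lets it compare
  \<open>S i\<close> with its concrete form at once. Testing against the difference d = T1 f - T2 f
  itself gives ||d||^2 = 0.\<close>

lemma adjoint_unique:
  assumes T1: "is_adjoint T T1" and T2: "is_adjoint T' T2" and eq: "op_eq T T'"
    and T: "bounded_op T" "bounded_op T'"
  shows "op_eq T1 T2"
  unfolding op_eq_def
proof (intro allI impI)
  fix f assume f: "L2 f"
  have b1: "L2 (T1 f)" and b2: "L2 (T2 f)" using T1 T2 f by (auto simp: is_adjoint_def bounded_op_L2)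
  define d where "d = (\<lambda>z. T1 f z + (-1) * T2 f z)"
  have d: "L2 d" unfolding d_def by (rule L2_linear[OF b1 b2])
  note [measurable] = L2_measurable[OF f] L2_measurable[OF bounded_op_L2[OF T(1) d]]
    L2_measurable[OF bounded_op_L2[OF T(2) d]] L2_measurable[OF d]
  have "l2_inner (T1 f) d = l2_inner f (T d)" "l2_inner (T2 f) d = l2_inner f (T' d)"
    using T1 T2 f d by (auto simp: is_adjoint_def)
  moreover have "l2_inner f (T d) = l2_inner f (T' d)"
    unfolding l2_inner_def
  proof (rule integral_cong_AE)
    have "AE z in circle_measure. T d z = T' d z" using eq d by (simp add: op_eq_def)
    then show "AE z in circle_measure. cnj (f z) * T d z = cnj (f z) * T' d z"
      by eventually_elim simp
  qed auto
  ultimately have "l2_inner (T1 f) d - l2_inner (T2 f) d = 0" by simp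
  also have "l2_inner (T1 f) d - l2_inner (T2 f) d = l2_inner d d"
    unfolding l2_inner_def
      Bochner_Integration.integral_diff[OF integrable_L2_mult[OF b1 d] integrable_L2_mult[OF b2 d], symmetric]
    by (rule Bochner_Integration.integral_cong) (auto simp: d_def algebra_simps)
  finally have "(\<integral>z. (cmod (d z))\<^sup>2 \<partial>circle_measure) = 0"
    unfolding l2_inner_self by simp
  then have "AE z in circle_measure. (cmod (d z))\<^sup>2 = 0"
    using d by (subst (asm) integral_nonneg_eq_0_iff_AE) (auto simp: L2_def)
  then show "AE z in circle_measure. T1 f z = T2 f z" by eventually_elim (simp add: d_def)
qed

section \<open>Weighted composition operators and their adjoints\<close>

context blaschke_product begin

text \<open>On the fibre over z the composition with b is constant, so the sum is N g(z): b carries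
  the measure with density \<open>poisson_sum\<close> to N times the circle measure.\<close>

lemma nn_integral_fiber_blaschke:
  assumes [measurable]: "g \<in> borel_measurable borel"
  shows "(\<integral>\<^sup>+z. g (b z) * ennreal (poisson_sum z) \<partial>circle_measure) = of_nat N * (\<integral>\<^sup>+z. g z \<partial>circle_measure)"
proof -
  have "(\<integral>\<^sup>+z. g (b z) * ennreal (poisson_sum z) \<partial>circle_measure)
     = (\<integral>\<^sup>+z. (\<Sum>j<N. g (b (preim j z))) \<partial>circle_measure)"
    by (rule nn_integral_poisson_sum) measurable
  also have "\<dots> = (\<integral>\<^sup>+z. of_nat N * g z \<partial>circle_measure)"
  proof (rule nn_integral_cong_AE)
    show "AE z in circle_measure. (\<Sum>j<N. g (b (preim j z))) = of_nat N * g z"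
      using AE_circle_measure_cmod by eventually_elim (simp add: blaschke_preim)
  qed
  finally show ?thesis by (simp add: nn_integral_cmult)
qed

text \<open>The preimage under b of a null set has measure 0 for the density
  \<open>poisson_sum\<close>, which is positive on the circle. Composition with b is thereby well
  defined on classes of functions.\<close>

lemma AE_blaschke:
  assumes "AE z in circle_measure. P z" shows "AE z in circle_measure. P (b z)"
proof -
  obtain E where E: "{z \<in> space circle_measure. \<not> P z} \<subseteq> E" "emeasure circle_measure E = 0" "E \<in> sets circle_measure"
    using assms by (rule AE_E)
  then have [measurable]: "E \<in> sets borel" by simp
  have "(\<integral>\<^sup>+z. indicator E (b z) * ennreal (poisson_sum z) \<partial>circle_measure) = 0"
    using E by (subst nn_integral_fiber_blaschke) auto
  then have "AE z in circle_measure. indicator E (b z) * ennreal (poisson_sum z) = 0"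
    by (subst (asm) nn_integral_0_iff_AE) auto
  then show ?thesis using AE_circle_measure_cmod
  proof eventually_elim
    case (elim z)
    then have "b z \<notin> E" using poisson_sum_pos[of z] by (auto simp: indicator_def ennreal_eq_0_iff split: if_splits)
    then show ?case using E by auto
  qed
qed

text \<open>Counterpart of \<open>AE_blaschke\<close> for the inverse branches: the mean number of
  fibre points in a null set E is the integral of \<open>poisson_sum\<close> over E, hence 0. Fibre
  means are thereby well defined on classes of functions.\<close>

lemma AE_fiber:
  assumes "AE z in circle_measure. P z"
  shows "AE z in circle_measure. \<forall>j<N. P (preim j z)"
proof -
  obtain E where E: "{z \<in> space circle_measure. \<not> P z} \<subseteq> E" "emeasure circle_measure E = 0" "E \<in> sets circle_measure"
    using assms by (rule AE_E)
  then have [measurable]: "E \<in> sets borel" by simp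
  have "AE z in circle_measure. z \<notin> E" using E by (intro AE_not_in) (auto simp: null_sets_def)
  then have "(\<integral>\<^sup>+z. indicator E z * ennreal (poisson_sum z) \<partial>circle_measure) = 0"
    by (subst nn_integral_0_iff_AE) (auto elim: eventually_mono)
  then have "(\<integral>\<^sup>+z. (\<Sum>j<N. indicator E (preim j z)) \<partial>circle_measure) = 0"
    by (subst (asm) nn_integral_poisson_sum) auto
  then have "AE z in circle_measure. (\<Sum>j<N. indicator E (preim j z) :: ennreal) = 0"
    by (subst (asm) nn_integral_0_iff_AE) auto
  then show ?thesis
  proof eventually_elim
    case (elim z)
    then have "\<forall>j<N. preim j z \<notin> E" by (auto simp: indicator_def split: if_splits)
    then show ?case using E by auto
  qed
qed

text \<open>The nonnegative change of variables says that the measure with density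
  \<open>poisson_sum\<close> is the image, under (j, z) -> preim j z, of counting measure times
  circle measure. Integrability and integrals of complex functions then carry over together.\<close>

lemma integral_poisson_sum:
  fixes g :: "complex \<Rightarrow> complex"
  assumes [measurable]: "g \<in> borel_measurable borel"
    and int: "integrable circle_measure (\<lambda>z. poisson_sum z *\<^sub>R g z)"
  shows "(\<integral>z. (\<Sum>j<N. g (preim j z)) \<partial>circle_measure) = (\<integral>z. poisson_sum z *\<^sub>R g z \<partial>circle_measure)"
proof -
  let ?C = "count_space {..<N}"
  let ?D = "density circle_measure (\<lambda>z. ennreal (poisson_sum z))"
  let ?P = "?C \<Otimes>\<^sub>M circle_measure"
  let ?f = "\<lambda>(j, z). preim j z"
  interpret C: sigma_finite_measure ?C by (rule sigma_finite_measure_count_space_finite) simp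
  interpret pair_sigma_finite ?C circle_measure ..
  have [measurable]: "?f \<in> borel_measurable ?P"
    by (rule measurable_pair_measure_countable1) (auto simp: countable_finite)
  have nonneg: "AE z in circle_measure. 0 \<le> poisson_sum z"
    using AE_circle_measure_cmod by eventually_elim (simp add: less_imp_le poisson_sum_pos)
  have D: "?D = distr ?P borel ?f"
  proof (rule measure_eqI)
    fix E assume "E \<in> sets ?D"
    then have [measurable]: "E \<in> sets borel" by simp
    have "emeasure ?D E = (\<integral>\<^sup>+z. indicator E z * ennreal (poisson_sum z) \<partial>circle_measure)"
      by (subst emeasure_density) (auto simp: mult.commute)
    also have "\<dots> = (\<integral>\<^sup>+z. (\<Sum>j<N. indicator E (preim j z)) \<partial>circle_measure)"
      by (rule nn_integral_poisson_sum) measurable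
    also have "\<dots> = (\<integral>\<^sup>+z. (\<integral>\<^sup>+j. indicator E (preim j z) \<partial>?C) \<partial>circle_measure)"
      by (simp add: nn_integral_count_space_finite)
    also have "\<dots> = (\<integral>\<^sup>+x. indicator E (?f x) \<partial>?P)"
      by (subst nn_integral_snd[symmetric]) auto
    also have "\<dots> = emeasure (distr ?P borel ?f) E"
      by (subst nn_integral_distr[symmetric, where f="indicator E" and M'=borel]) auto
    finally show "emeasure ?D E = emeasure (distr ?P borel ?f) E" .
  qed simp
  have "integrable ?D g" using int nonneg by (subst integrable_density) auto
  then have i: "integrable ?P (\<lambda>x. g (?f x))"
    unfolding D by (subst (asm) integrable_distr_eq) auto
  have "(\<integral>z. poisson_sum z *\<^sub>R g z \<partial>circle_measure) = integral\<^sup>L ?D g"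
    using nonneg by (subst integral_density) auto
  also have "\<dots> = (\<integral>x. g (?f x) \<partial>?P)"
    unfolding D by (rule integral_distr) auto
  also have "\<dots> = (\<integral>z. (\<integral>j. g (preim j z) \<partial>?C) \<partial>circle_measure)"
    using integral_snd[of "\<lambda>j z. g (preim j z)"] i by (simp add: case_prod_beta')
  finally show ?thesis by (simp add: lebesgue_integral_count_space_finite)
qed

text \<open>Agrees with the transfer operator on the circle and, unlike it, is Borel measurable on the whole plane.\<close>
definition fiber_mean :: "(complex \<Rightarrow> complex) \<Rightarrow> complex \<Rightarrow> complex" where
  "fiber_mean g z = (1 / of_nat N) * (\<Sum>j<N. g (preim j z))"

lemma transfer_eq_fiber_mean: "cmod z = 1 \<Longrightarrow> transfer N b g z = fiber_mean g z"
  by (simp add: transfer_def fiber_mean_def sum_fiber)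

lemma measurable_fiber_mean [measurable]:
  assumes [measurable]: "g \<in> borel_measurable borel"
  shows "fiber_mean g \<in> borel_measurable borel"
  unfolding fiber_mean_def[abs_def] by measurable

lemma cmod_preim [simp]: "cmod (preim j z) = 1"
  by (simp add: preim_def)

text \<open>Cauchy-Schwarz on the N points of a fibre, followed by the change of variables; the
  resulting weight \<open>poisson_sum\<close> / N is |k|^2.\<close>

lemma nn_norm2_fiber_mean:
  assumes [measurable]: "g \<in> borel_measurable borel"
  shows "nn_norm2 (fiber_mean g) \<le> nn_norm2 (\<lambda>z. k z * g z)"
proof -
  have "nn_norm2 (fiber_mean g) \<le> (\<integral>\<^sup>+z. (\<Sum>j<N. ennreal ((cmod (g (preim j z)))\<^sup>2 / N)) \<partial>circle_measure)"
    unfolding nn_norm2_def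
  proof (rule nn_integral_mono)
    fix z
    have N: "real N > 0" using N_pos by simp
    have "(cmod (\<Sum>j<N. g (preim j z)))\<^sup>2 \<le> (\<Sum>j<N. cmod (g (preim j z)))\<^sup>2"
      by (intro power_mono norm_sum) auto
    also have "\<dots> \<le> (\<Sum>j<N. (cmod (g (preim j z)))\<^sup>2) * N"
      using sum_squared_le_sum_of_squares[of "\<lambda>j. cmod (g (preim j z))" "{..<N}"] by simp
    finally have "(cmod (fiber_mean g z))\<^sup>2 \<le> (\<Sum>j<N. (cmod (g (preim j z)))\<^sup>2 / N)"
      using N by (simp add: fiber_mean_def norm_mult norm_divide power_divide divide_le_eq
          power2_eq_square[of "real N"] flip: sum_divide_distrib)
    then show "ennreal ((cmod (fiber_mean g z))\<^sup>2) \<le> (\<Sum>j<N. ennreal ((cmod (g (preim j z)))\<^sup>2 / N))"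
      by (subst sum_ennreal) (auto intro: ennreal_leI)
  qed
  also have "\<dots> = (\<integral>\<^sup>+z. ennreal ((cmod (g z))\<^sup>2 / N) * ennreal (poisson_sum z) \<partial>circle_measure)"
    by (rule nn_integral_poisson_sum[symmetric]) measurable
  also have "\<dots> = nn_norm2 (\<lambda>z. k z * g z)"
    unfolding nn_norm2_def
  proof (rule nn_integral_cong_AE)
    show "AE z in circle_measure. ennreal ((cmod (g z))\<^sup>2 / N) * ennreal (poisson_sum z)
        = ennreal ((cmod (k z * g z))\<^sup>2)"
      using AE_circle_measure_cmod
    proof eventually_elim
      case (elim z)
      then show ?case using poisson_sum_pos[of z]
        by (subst ennreal_mult[symmetric])
           (auto simp: norm_mult power_mult_distrib cmod_J_sqrt_bd mult.commute)
    qed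
  qed
  finally show ?thesis .
qed

section \<open>The operators pi(m) C_b and their explicit adjoints\<close>

abbreviation W :: "(complex \<Rightarrow> complex) \<Rightarrow> op" where
  "W m \<equiv> (\<lambda>f. mult_op m (C_b N \<alpha> f))"

definition W_adj :: "(complex \<Rightarrow> complex) \<Rightarrow> op" where
  "W_adj m h = fiber_mean (\<lambda>w. cnj (m w) * h w / k w)"

lemma W_eq: "W m f z = m z * (k z * f (b z))"
  by (simp add: mult_op_def C_b_def)

text \<open>This is what the weight J^(1/2) in \<open>C_b\<close> is for: |k|^2 is the density that
  b carries to the circle measure.\<close>

lemma nn_norm2_C_b:
  assumes [measurable]: "f \<in> borel_measurable borel"
  shows "nn_norm2 (C_b N \<alpha> f) = nn_norm2 f"
proof -
  have "nn_norm2 (C_b N \<alpha> f) = (\<integral>\<^sup>+z. ennreal ((cmod (f (b z)))\<^sup>2 / N) * ennreal (poisson_sum z) \<partial>circle_measure)"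
    unfolding nn_norm2_def
  proof (rule nn_integral_cong_AE)
    show "AE z in circle_measure. ennreal ((cmod (C_b N \<alpha> f z))\<^sup>2)
        = ennreal ((cmod (f (b z)))\<^sup>2 / N) * ennreal (poisson_sum z)"
      using AE_circle_measure_cmod
    proof eventually_elim
      case (elim z)
      then show ?case using poisson_sum_pos[of z]
        by (subst ennreal_mult[symmetric])
           (auto simp: C_b_def norm_mult power_mult_distrib cmod_J_sqrt_bd mult.commute)
    qed
  qed
  also have "\<dots> = of_nat N * (\<integral>\<^sup>+z. ennreal ((cmod (f z))\<^sup>2 / N) \<partial>circle_measure)"
    by (rule nn_integral_fiber_blaschke) measurable
  also have "\<dots> = (\<integral>\<^sup>+z. of_nat N * ennreal ((cmod (f z))\<^sup>2 / N) \<partial>circle_measure)"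
    by (rule nn_integral_cmult[symmetric]) measurable
  also have "\<dots> = nn_norm2 f"
    unfolding nn_norm2_def using N_pos
    by (intro nn_integral_cong) (simp add: ennreal_of_nat_eq_real_of_nat flip: ennreal_mult)
  finally show ?thesis .
qed

lemma measurable_C_b [measurable]:
  assumes [measurable]: "f \<in> borel_measurable borel"
  shows "C_b N \<alpha> f \<in> borel_measurable borel"
  unfolding C_b_def by measurable

lemma bounded_op_W:
  assumes m: "Linf m" shows "bounded_op (W m)"
proof -
  note [measurable] = Linf_measurable[OF m]
  obtain C where C: "AE z in circle_measure. cmod (m z) \<le> C" using m by (auto simp: Linf_def)
  show ?thesis
  proof (rule bounded_opI[where C=C])
    fix f :: "complex \<Rightarrow> complex" assume [measurable]: "f \<in> borel_measurable borel"
    show "W m f \<in> borel_measurable borel" unfolding mult_op_def by measurable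
    have "AE z in circle_measure. cmod (W m f z) \<le> C * cmod (C_b N \<alpha> f z)"
      using C by eventually_elim (auto simp: mult_op_def norm_mult intro: mult_right_mono)
    then have "nn_norm2 (W m f) \<le> ennreal (C\<^sup>2) * nn_norm2 (C_b N \<alpha> f)"
      by (intro nn_norm2_mono_AE) auto
    then show "nn_norm2 (W m f) \<le> ennreal (C\<^sup>2) * nn_norm2 f" by (simp add: nn_norm2_C_b)
  next
    fix f g :: "complex \<Rightarrow> complex" assume "AE z in circle_measure. f z = g z"
    then have "AE z in circle_measure. f (b z) = g (b z)" by (rule AE_blaschke)
    then show "AE z in circle_measure. W m f z = W m g z"
      by eventually_elim (simp add: W_eq)
  qed (simp add: W_eq algebra_simps)
qed

lemma bounded_op_W_adj:
  assumes m: "Linf m" shows "bounded_op (W_adj m)"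
proof -
  note [measurable] = Linf_measurable[OF m]
  obtain C where C: "AE z in circle_measure. cmod (m z) \<le> C" using m by (auto simp: Linf_def)
  show ?thesis
  proof (rule bounded_opI[where C=C])
    fix h :: "complex \<Rightarrow> complex" assume [measurable]: "h \<in> borel_measurable borel"
    show "W_adj m h \<in> borel_measurable borel" unfolding W_adj_def by measurable
    have "AE z in circle_measure. cmod (k z * (cnj (m z) * h z / k z)) \<le> C * cmod (h z)"
      using C AE_circle_measure_cmod
      by eventually_elim (auto simp: norm_mult norm_divide J_sqrt_bd_nonzero intro: mult_right_mono)
    then have "nn_norm2 (\<lambda>z. k z * (cnj (m z) * h z / k z)) \<le> ennreal (C\<^sup>2) * nn_norm2 h"
      by (intro nn_norm2_mono_AE) auto
    then show "nn_norm2 (W_adj m h) \<le> ennreal (C\<^sup>2) * nn_norm2 h"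
      unfolding W_adj_def by (intro order_trans[OF nn_norm2_fiber_mean]) auto
  next
    fix f g :: "complex \<Rightarrow> complex" assume "AE z in circle_measure. f z = g z"
    then have "AE z in circle_measure. \<forall>j<N. f (preim j z) = g (preim j z)" by (rule AE_fiber)
    then show "AE z in circle_measure. W_adj m f z = W_adj m g z"
      by eventually_elim (simp add: W_adj_def fiber_mean_def)
  next
    fix f g c z
    show "W_adj m (\<lambda>w. f w + c * g w) z = W_adj m f z + c * W_adj m g z"
      unfolding W_adj_def fiber_mean_def
      by (simp add: sum_distrib_left algebra_simps add_divide_distrib sum.distrib)
  qed
qed

lemma is_adjoint_W:
  assumes m: "Linf m" shows "is_adjoint (W m) (W_adj m)"
  unfolding is_adjoint_def
proof (intro conjI allI impI)
  note [measurable] = Linf_measurable[OF m]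
  fix f g assume f: "L2 f" and g: "L2 g"
  note [measurable] = L2_measurable[OF f] L2_measurable[OF g]
  \<comment> \<open>The integrand divided by the density \<open>poisson_sum\<close> = N k cnj k; one
    factor k cancels, and 1 / (N cnj k) is the weight of the conjugated fibre mean.\<close>
  let ?q = "\<lambda>z. m z * cnj (f z) / (of_nat N * cnj (k z)) * g (b z)"
  have eq: "AE z in circle_measure. cnj (f z) * W m g z = poisson_sum z *\<^sub>R ?q z"
    using AE_circle_measure_cmod
  proof eventually_elim
    case (elim z)
    have "of_real (poisson_sum z) = of_nat N * (of_real ((cmod (k z))\<^sup>2) :: complex)"
      using N_pos by (simp add: cmod_J_sqrt_bd[OF elim])
    also have "of_real ((cmod (k z))\<^sup>2) = k z * cnj (k z)"
      by (metis complex_norm_square of_real_power)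
    finally show ?case using J_sqrt_bd_nonzero[OF elim] N_pos by (simp add: W_eq scaleR_conv_of_real)
  qed
  have "integrable circle_measure (\<lambda>z. cnj (f z) * W m g z)"
    by (rule integrable_L2_mult[OF f bounded_op_L2[OF bounded_op_W[OF m] g]])
  then have int: "integrable circle_measure (\<lambda>z. poisson_sum z *\<^sub>R ?q z)"
    by (subst (asm) integrable_cong_AE[OF _ _ eq]) (auto simp: W_eq)
  have "l2_inner f (W m g) = (\<integral>z. poisson_sum z *\<^sub>R ?q z \<partial>circle_measure)"
    unfolding l2_inner_def by (rule integral_cong_AE[OF _ _ eq]) (auto simp: W_eq)
  also have "\<dots> = (\<integral>z. (\<Sum>j<N. ?q (preim j z)) \<partial>circle_measure)"
    by (rule integral_poisson_sum[symmetric, OF _ int]) measurable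
  also have "\<dots> = l2_inner (W_adj m f) g"
    unfolding l2_inner_def
  proof (rule integral_cong_AE)
    show "AE z in circle_measure. (\<Sum>j<N. ?q (preim j z)) = cnj (W_adj m f z) * g z"
      using AE_circle_measure_cmod
    proof eventually_elim
      case (elim z)
      then show ?case unfolding W_adj_def fiber_mean_def
        by (simp add: blaschke_preim sum_distrib_left sum_distrib_right)
    qed
  qed (auto simp: W_adj_def)
  finally show "l2_inner (W_adj m f) g = l2_inner f (W m g)" by simp
qed (rule bounded_op_W_adj[OF m])

text \<open>On a fibre the weight k cancels and f o b is constant, so \<open>W_adj m\<close> after
  \<open>W m'\<close> is multiplication by the module inner product of m and m'. Orthonormality thus
  corresponds to the relations S_i^* S_j = \<delta>_ij.\<close>

lemma W_adj_W:
  assumes z: "cmod z = 1"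
  shows "W_adj m (W m' f) z = fiber_mean (\<lambda>w. cnj (m w) * m' w) z * f z"
proof -
  have "(\<Sum>j<N. cnj (m (preim j z)) * W m' f (preim j z) / k (preim j z))
    = (\<Sum>j<N. cnj (m (preim j z)) * m' (preim j z) * f z)"
    by (intro sum.cong refl) (simp add: W_eq blaschke_preim z J_sqrt_bd_nonzero)
  then show ?thesis unfolding W_adj_def fiber_mean_def by (simp add: sum_distrib_right)
qed

text \<open>Inserting k f instead of f cancels the weight, so these terms sum to k times the
  reconstruction formula for f.\<close>

lemma W_W_adj: "W m (W_adj m (\<lambda>w. k w * f w)) z = k z * (m z * fiber_mean (\<lambda>w. cnj (m w) * f w) (b z))"
  by (simp add: W_eq W_adj_def fiber_mean_def J_sqrt_bd_nonzero)

lemma module_inner_eq: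
  "cmod z = 1 \<Longrightarrow> module_inner N b f g z = fiber_mean (\<lambda>w. cnj (f w) * g w) z"
  by (simp add: module_inner_def transfer_eq_fiber_mean)

lemma fiber_mean_cong_at_blaschke:
  assumes z: "cmod z = 1" and eq: "\<And>w. cmod w = 1 \<Longrightarrow> b w = b z \<Longrightarrow> f w = g w"
  shows "fiber_mean f (b z) = fiber_mean g (b z)"
proof -
  have "cmod (b z) = 1" using z by (simp add: cmod_blaschke_eq_1_iff)
  then show ?thesis unfolding fiber_mean_def
    by (intro arg_cong2[where f="(*)"] sum.cong refl eq) (auto simp: blaschke_preim)
qed

text \<open>The reconstruction formula only involves the finite fibre through a point, on which a
  function agrees with its truncations at sufficiently high levels.\<close>
lemma module_onb_reconstruction:
  assumes onb: "module_onb N b m" and [measurable]: "g \<in> borel_measurable borel"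
  shows "AE z in circle_measure. g z = (\<Sum>i<N. m i z * fiber_mean (\<lambda>w. cnj (m i w) * g w) (b z))"
proof -
  define t where "t n z = (if cmod (g z) \<le> real n then g z else 0)" for n :: nat and z
  have "Linf (t n)" for n
    unfolding Linf_def
  proof
    show "t n \<in> borel_measurable circle_measure" unfolding t_def[abs_def] by measurable
    show "\<exists>C. AE z in circle_measure. cmod (t n z) \<le> C"
      by (rule exI[of _ "real n"]) (auto simp: t_def)
  qed
  then have "AE z in circle_measure. t n z = (\<Sum>i<N. m i z * beta b (module_inner N b (m i) (t n)) z)" for n
    using onb by (simp add: module_onb_def)
  \<comment> \<open>One null set serves all truncation levels, so the level may depend on z.\<close>
  then have "AE z in circle_measure. \<forall>n. t n z = (\<Sum>i<N. m i z * beta b (module_inner N b (m i) (t n)) z)"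
    by (simp add: AE_all_countable)
  then show ?thesis using AE_circle_measure_cmod
  proof eventually_elim
    case (elim z)
    have bz: "cmod (b z) = 1" using elim(2) by (simp add: cmod_blaschke_eq_1_iff)
    obtain n :: nat where n: "(\<Sum>j<N. cmod (g (preim j (b z)))) \<le> real n"
      using real_arch_simple by blast
    have tn: "t n w = g w" if "b w = b z" for w
    proof -
      have "w \<in> {w. b w = b z}" using that by simp
      then obtain j where j: "j \<in> {..<N}" "w = preim j (b z)" unfolding fiber_eq[OF bz] by blast
      have "cmod (g (preim j (b z))) \<le> (\<Sum>j<N. cmod (g (preim j (b z))))"
        by (rule member_le_sum[OF j(1)]) auto
      then have "cmod (g w) \<le> (\<Sum>j<N. cmod (g (preim j (b z))))" by (simp only: j(2))
      then show ?thesis using n by (simp add: t_def)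
    qed
    have "fiber_mean (\<lambda>w. cnj (m i w) * t n w) (b z) = fiber_mean (\<lambda>w. cnj (m i w) * g w) (b z)" for i
      by (rule fiber_mean_cong_at_blaschke[OF elim(2)]) (simp add: tn)
    then show ?case using elim(1)[rule_format, of n] tn[of z]
      by (simp add: beta_def module_inner_eq bz)
  qed
qed

section \<open>Passage between orthonormal bases and Cuntz families\<close>

lemma cuntz_family_adjoint:
  assumes "cuntz_family N S" "i < N"
  shows "bounded_op (S i)" "is_adjoint (S i) (op_adjoint (S i))" "bounded_op (op_adjoint (S i))"
  using assms is_adjoint_op_adjoint unfolding cuntz_family_def is_adjoint_def by blast+

lemma op_eqD: "op_eq S T \<Longrightarrow> L2 f \<Longrightarrow> AE z in circle_measure. S f z = T f z"
  by (simp add: op_eq_def)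

lemma op_adjoint_W:
  assumes "Linf m" shows "op_eq (op_adjoint (W m)) (W_adj m)"
  by (rule adjoint_unique[OF is_adjoint_op_adjoint[OF is_adjoint_W] is_adjoint_W _ bounded_op_W bounded_op_W, OF assms assms _ assms assms])
    (simp add: op_eq_def)

lemma W_adj_W_AE:
  "AE z in circle_measure. W_adj m (W m' f) z = module_inner N b m m' z * f z"
  using AE_circle_measure_cmod by eventually_elim (simp add: W_adj_W module_inner_eq)

lemma cuntz_family_of_onb:
  assumes onb: "module_onb N b m"
  shows "cuntz_family N (\<lambda>i. W (m i))"
proof -
  have m: "Linf (m i)" if "i < N" for i using onb that by (simp add: module_onb_def)
  have 2: "op_eq (\<lambda>f. op_adjoint (W (m i)) (W (m j) f)) (if i = j then (\<lambda>f. f) else (\<lambda>f z. 0))"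
    if ij: "i < N" "j < N" for i j
    unfolding op_eq_def
  proof (intro allI impI)
    fix f assume f: "L2 f"
    have "AE z in circle_measure. op_adjoint (W (m i)) (W (m j) f) z = W_adj (m i) (W (m j) f) z"
      by (rule op_eqD[OF op_adjoint_W[OF m[OF ij(1)]] bounded_op_L2[OF bounded_op_W[OF m[OF ij(2)]] f]])
    moreover have "AE z in circle_measure. module_inner N b (m i) (m j) z = (if i = j then 1 else 0)"
      using onb ij by (simp add: module_onb_def)
    moreover note W_adj_W_AE[of "m i" "m j" f]
    ultimately show "AE z in circle_measure. op_adjoint (W (m i)) (W (m j) f) z
        = (if i = j then (\<lambda>f. f) else (\<lambda>f z. 0)) f z"
      by eventually_elim simp
  qed
  have 3: "op_eq (\<lambda>f z. \<Sum>i<N. W (m i) (op_adjoint (W (m i)) f) z) (\<lambda>f. f)"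
    unfolding op_eq_def
  proof (intro allI impI)
    fix f assume f: "L2 f"
    note [measurable] = L2_measurable[OF f]
    \<comment> \<open>The adjoint gets evaluated at b z, so its almost everywhere formula has to be
      pulled back along b.\<close>
    have "AE z in circle_measure. \<forall>i\<in>{..<N}. op_adjoint (W (m i)) f (b z) = W_adj (m i) f (b z)"
      by (intro AE_finite_allI AE_blaschke op_eqD[OF op_adjoint_W[OF m] f]) auto
    \<comment> \<open>The reconstruction formula is applied to f / k, which is in general unbounded;
      \<open>W_adj\<close> already carries the division by k.\<close>
    moreover have "AE z in circle_measure. f z / k z
        = (\<Sum>i<N. m i z * fiber_mean (\<lambda>w. cnj (m i w) * (f w / k w)) (b z))"
      by (rule module_onb_reconstruction[OF onb]) measurable
    ultimately show "AE z in circle_measure. (\<Sum>i<N. W (m i) (op_adjoint (W (m i)) f) z) = f z"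
      using AE_circle_measure_cmod
    proof eventually_elim
      case (elim z)
      have "(\<Sum>i<N. W (m i) (op_adjoint (W (m i)) f) z) = k z * (\<Sum>i<N. m i z * W_adj (m i) f (b z))"
        using elim(1) by (simp add: W_eq sum_distrib_left mult_ac)
      also have "(\<Sum>i<N. m i z * W_adj (m i) f (b z)) = f z / k z"
        using elim(2) by (simp add: W_adj_def)
      finally show ?case using J_sqrt_bd_nonzero[OF elim(3)] by simp
    qed
  qed
  have "bounded_op (W (m i)) \<and> (\<exists>Ts. is_adjoint (W (m i)) Ts)" if "i < N" for i
    using bounded_op_W is_adjoint_W m[OF that] by blast
  then show ?thesis unfolding cuntz_family_def using 2 3 by blast
qed

text \<open>The symbol leaves every term as the common factor \<phi>(b z), since W(\<phi> h) =
  (\<phi> o b) W h; what remains is the relation that the range projections sum to the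
  identity.\<close>

lemma alpha_S_W:
  assumes "cuntz_family N (\<lambda>i. W (m i))"
  shows "op_eq (alpha_S N (\<lambda>i. W (m i)) (mult_op \<phi>)) (mult_op (beta b \<phi>))"
  unfolding op_eq_def
proof (intro allI impI)
  fix f assume "L2 f"
  then have "AE z in circle_measure. (\<Sum>i<N. W (m i) (op_adjoint (W (m i)) f) z) = f z"
    using assms by (simp add: cuntz_family_def op_eq_def)
  then show "AE z in circle_measure. alpha_S N (\<lambda>i. W (m i)) (mult_op \<phi>) f z = mult_op (beta b \<phi>) f z"
  proof eventually_elim
    case (elim z)
    have "alpha_S N (\<lambda>i. W (m i)) (mult_op \<phi>) f z = \<phi> (b z) * (\<Sum>i<N. W (m i) (op_adjoint (W (m i)) f) z)"
      by (simp add: alpha_S_def W_eq mult_op_def[of \<phi>] sum_distrib_left mult_ac)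
    then show ?case using elim by (simp add: mult_op_def beta_def)
  qed
qed

text \<open>k is \<open>C_b\<close> applied to the constant 1, and \<open>C_b\<close> preserves the
  norm.\<close>

lemma L2_J_sqrt_bd: "L2 k"
proof -
  have "L2 (C_b N \<alpha> (\<lambda>_. 1))"
    using L2_const[of 1] by (simp add: L2_iff nn_norm2_C_b)
  then show ?thesis by (simp add: C_b_def)
qed

text \<open>Orthonormality is read off at the constant 1, where \<open>W_adj\<close> after
  \<open>W\<close> returns the inner product itself; reconstruction is read off at k f. Equality
  with W is asked only almost everywhere, which covers both an abstract family and the concrete
  one.\<close>

lemma onb_of_cuntz_family:
  assumes cf: "cuntz_family N S" and m: "\<And>i. i < N \<Longrightarrow> Linf (m i)"
    and eq: "\<And>i. i < N \<Longrightarrow> op_eq (S i) (W (m i))"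
  shows "module_onb N b m"
proof -
  have adj: "op_eq (op_adjoint (S i)) (W_adj (m i))" if "i < N" for i
    by (rule adjoint_unique[OF cuntz_family_adjoint(2)[OF cf that] is_adjoint_W[OF m[OF that]] eq[OF that]
          cuntz_family_adjoint(1)[OF cf that] bounded_op_W[OF m[OF that]]])
  have orth: "AE z in circle_measure. module_inner N b (m i) (m j) z = (if i = j then 1 else 0)"
    if ij: "i < N" "j < N" for i j
  proof -
    let ?o = "\<lambda>_. 1 :: complex"
    have o: "L2 ?o" by (rule L2_const)
    have So: "L2 (S j ?o)" "L2 (W (m j) ?o)"
      by (rule bounded_op_L2[OF cuntz_family_adjoint(1)[OF cf ij(2)] o],
          rule bounded_op_L2[OF bounded_op_W[OF m[OF ij(2)]] o])
    have "AE z in circle_measure. op_adjoint (S i) (S j ?o) z = (if i = j then (\<lambda>f. f) else (\<lambda>f z. 0)) ?o z"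
      using cf ij o unfolding cuntz_family_def op_eq_def by blast
    moreover have "AE z in circle_measure. op_adjoint (S i) (S j ?o) z = W_adj (m i) (S j ?o) z"
      by (rule op_eqD[OF adj[OF ij(1)] So(1)])
    moreover have "AE z in circle_measure. W_adj (m i) (S j ?o) z = W_adj (m i) (W (m j) ?o) z"
      by (rule bounded_op_cong[OF bounded_op_W_adj[OF m[OF ij(1)]] So op_eqD[OF eq[OF ij(2)] o]])
    moreover note W_adj_W_AE[of "m i" "m j" ?o]
    ultimately show ?thesis by eventually_elim (auto split: if_splits)
  qed
  have recon: "AE z in circle_measure. f z = (\<Sum>i<N. m i z * beta b (module_inner N b (m i) f) z)"
    if f: "Linf f" for f
  proof -
    let ?h = "\<lambda>z. k z * f z"
    have h: "L2 ?h" using L2_bounded_mult[OF L2_J_sqrt_bd f] by (simp add: mult.commute)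
    have "AE z in circle_measure. S i (op_adjoint (S i) ?h) z = W (m i) (W_adj (m i) ?h) z"
      if i: "i < N" for i
    proof -
      have a: "L2 (op_adjoint (S i) ?h)"
        by (rule bounded_op_L2[OF cuntz_family_adjoint(3)[OF cf i] h])
      have w: "L2 (W_adj (m i) ?h)"
        by (rule bounded_op_L2[OF bounded_op_W_adj[OF m[OF i]] h])
      have "AE z in circle_measure. S i (op_adjoint (S i) ?h) z = W (m i) (op_adjoint (S i) ?h) z"
        by (rule op_eqD[OF eq[OF i] a])
      moreover have "AE z in circle_measure. W (m i) (op_adjoint (S i) ?h) z = W (m i) (W_adj (m i) ?h) z"
        by (rule bounded_op_cong[OF bounded_op_W[OF m[OF i]] a w op_eqD[OF adj[OF i] h]])
      ultimately show ?thesis by eventually_elim simp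
    qed
    then have "AE z in circle_measure. \<forall>i\<in>{..<N}. S i (op_adjoint (S i) ?h) z = W (m i) (W_adj (m i) ?h) z"
      by (intro AE_finite_allI) auto
    moreover have "AE z in circle_measure. (\<Sum>i<N. S i (op_adjoint (S i) ?h) z) = ?h z"
      using cf h by (simp add: cuntz_family_def op_eq_def)
    ultimately show ?thesis using AE_circle_measure_cmod
    proof eventually_elim
      case (elim z)
      have bz: "cmod (b z) = 1" using elim(3) by (simp add: cmod_blaschke_eq_1_iff)
      have "k z * f z = (\<Sum>i<N. W (m i) (W_adj (m i) ?h) z)" using elim(1,2) by simp
      also have "\<dots> = k z * (\<Sum>i<N. m i z * fiber_mean (\<lambda>w. cnj (m i w) * f w) (b z))"
        unfolding W_W_adj by (simp add: sum_distrib_left)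
      finally show ?case
        using J_sqrt_bd_nonzero[OF elim(3)] by (simp add: beta_def module_inner_eq bz)
    qed
  qed
  show ?thesis unfolding module_onb_def using m orth recon by blast
qed

section \<open>Consequences of the covariance relation for an abstract family\<close>

text \<open>The covariance relation is applied to S_j f: orthogonality removes all terms with i
  distinct from j, and S_j^* S_j = 1 leaves S_j (\<phi> f).\<close>

lemma cuntz_family_intertwines:
  assumes cf: "cuntz_family N S"
    and al: "op_eq (alpha_S N S (mult_op \<phi>)) (mult_op (beta b \<phi>))"
    and \<phi>: "Linf \<phi>" and f: "L2 f" and j: "j < N"
  shows "AE z in circle_measure. S j (\<lambda>w. \<phi> w * f w) z = \<phi> (b z) * S j f z"
proof -
  have Sf: "L2 (S j f)" by (rule bounded_op_L2[OF cuntz_family_adjoint(1)[OF cf j] f])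
  have "AE z in circle_measure. S i (mult_op \<phi> (op_adjoint (S i) (S j f))) z
      = (if i = j then S j (\<lambda>w. \<phi> w * f w) z else 0)" if i: "i < N" for i
  proof -
    \<comment> \<open>For i distinct from j this is the zero function, which a bounded operator
      sends to 0 almost everywhere.\<close>
    let ?g = "\<lambda>w. \<phi> w * (if i = j then f w else 0)"
    have bS: "bounded_op (S i)" by (rule cuntz_family_adjoint(1)[OF cf i])
    have "AE z in circle_measure. op_adjoint (S i) (S j f) z = (if i = j then (\<lambda>f. f) else (\<lambda>f z. 0)) f z"
      using cf i j f unfolding cuntz_family_def op_eq_def by blast
    then have "AE z in circle_measure. mult_op \<phi> (op_adjoint (S i) (S j f)) z = ?g z"
      by eventually_elim (simp add: mult_op_def)
    moreover have "L2 (mult_op \<phi> (op_adjoint (S i) (S j f)))"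
      unfolding mult_op_def
      by (rule L2_bounded_mult[OF bounded_op_L2[OF cuntz_family_adjoint(3)[OF cf i] Sf] \<phi>])
    moreover have "L2 ?g" using f L2_const[of 0] by (intro L2_bounded_mult[OF _ \<phi>]) (cases "i = j"; simp)
    ultimately have "AE z in circle_measure. S i (mult_op \<phi> (op_adjoint (S i) (S j f))) z = S i ?g z"
      by (intro bounded_op_cong[OF bS])
    then show ?thesis using bounded_op_zero[OF bS] by eventually_elim auto
  qed
  then have "AE z in circle_measure. \<forall>i\<in>{..<N}. S i (mult_op \<phi> (op_adjoint (S i) (S j f))) z
      = (if i = j then S j (\<lambda>w. \<phi> w * f w) z else 0)"
    by (intro AE_finite_allI) auto
  moreover have "AE z in circle_measure. alpha_S N S (mult_op \<phi>) (S j f) z = mult_op (beta b \<phi>) (S j f) z"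
    by (rule op_eqD[OF al Sf])
  ultimately show ?thesis
  proof eventually_elim
    case (elim z)
    have "alpha_S N S (mult_op \<phi>) (S j f) z = S j (\<lambda>w. \<phi> w * f w) z"
      using elim(1) j by (simp add: alpha_S_def)
    then show ?case using elim(2) by (simp add: mult_op_def beta_def)
  qed
qed

lemma cuntz_family_isometry:
  assumes cf: "cuntz_family N S" and f: "L2 f" and j: "j < N"
  shows "nn_norm2 (S j f) = nn_norm2 f"
proof -
  have Sf: "L2 (S j f)" by (rule bounded_op_L2[OF cuntz_family_adjoint(1)[OF cf j] f])
  have eq: "AE z in circle_measure. op_adjoint (S j) (S j f) z = f z"
  proof -
    have "op_eq (\<lambda>f. op_adjoint (S j) (S j f)) (if j = j then (\<lambda>f. f) else (\<lambda>f z. 0))"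
      using cf j unfolding cuntz_family_def by blast
    then show ?thesis using f by (simp add: op_eq_def)
  qed
  note [measurable] = L2_measurable[OF f]
    L2_measurable[OF bounded_op_L2[OF cuntz_family_adjoint(3)[OF cf j] Sf]]
  have "l2_inner (S j f) (S j f) = l2_inner (op_adjoint (S j) (S j f)) f"
    using cuntz_family_adjoint(2)[OF cf j] Sf f by (simp add: is_adjoint_def)
  also have "\<dots> = l2_inner f f"
    unfolding l2_inner_def
    by (rule integral_cong_AE) (use eq in \<open>auto elim: eventually_mono\<close>)
  finally have "(\<integral>z. (cmod (S j f z))\<^sup>2 \<partial>circle_measure) = (\<integral>z. (cmod (f z))\<^sup>2 \<partial>circle_measure)"
    unfolding l2_inner_self by simp
  then show ?thesis
    using f Sf by (simp add: nn_norm2_def L2_def nn_integral_eq_integral)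
qed

text \<open>The isometry is tested on indicators: S_j 1_E = (1_E o b) S_j 1 and the change of
  variables turn its norm identity into the statement that \<open>G\<close> integrates over E to the
  measure of E. As E is arbitrary, uniqueness of densities gives G = 1 almost everywhere.\<close>

lemma cuntz_family_generator_bounded:
  assumes cf: "cuntz_family N S"
    and al: "\<And>\<phi>. Linf \<phi> \<Longrightarrow> op_eq (alpha_S N S (mult_op \<phi>)) (mult_op (beta b \<phi>))"
    and j: "j < N"
  shows "Linf (\<lambda>z. S j (\<lambda>_. 1) z / k z)"
proof -
  define \<mu> where "\<mu> z = S j (\<lambda>_. 1) z / k z" for z
  have So: "L2 (S j (\<lambda>_. 1))"
    by (rule bounded_op_L2[OF cuntz_family_adjoint(1)[OF cf j] L2_const])
  note [measurable] = L2_measurable[OF So]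
  have [measurable]: "\<mu> \<in> borel_measurable borel" unfolding \<mu>_def[abs_def] by measurable
  define G where "G z = (\<Sum>i<N. ennreal ((cmod (\<mu> (preim i z)))\<^sup>2 / N))" for z
  have [measurable]: "G \<in> borel_measurable borel" unfolding G_def[abs_def] by measurable
  have dens: "density circle_measure G = density circle_measure (\<lambda>_. 1)"
  proof (rule measure_eqI)
    fix E assume "E \<in> sets (density circle_measure G)"
    then have E[measurable]: "E \<in> sets borel" by simp
    let ?i = "\<lambda>z. indicator E z :: complex"
    have i: "Linf ?i" unfolding Linf_def
      by (auto intro!: exI[of _ 1] AE_I2 simp: indicator_def)
    have "AE z in circle_measure. S j (\<lambda>w. ?i w * 1) z = ?i (b z) * S j (\<lambda>_. 1) z"
      by (rule cuntz_family_intertwines[OF cf al[OF i] i L2_const j])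
    then have "nn_norm2 (S j ?i) = nn_norm2 (\<lambda>z. ?i (b z) * S j (\<lambda>_. 1) z)"
      by (intro nn_norm2_cong_AE) simp
    also have "\<dots> = (\<integral>\<^sup>+z. indicator E (b z) * ennreal ((cmod (\<mu> z))\<^sup>2 / N) * ennreal (poisson_sum z) \<partial>circle_measure)"
      unfolding nn_norm2_def
    proof (rule nn_integral_cong_AE)
      show "AE z in circle_measure. ennreal ((cmod (?i (b z) * S j (\<lambda>_. 1) z))\<^sup>2)
        = indicator E (b z) * ennreal ((cmod (\<mu> z))\<^sup>2 / N) * ennreal (poisson_sum z)"
        using AE_circle_measure_cmod
      proof eventually_elim
        case (elim z)
        have "(cmod (S j (\<lambda>_. 1) z))\<^sup>2 = (cmod (\<mu> z))\<^sup>2 * (cmod (k z))\<^sup>2"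
          using J_sqrt_bd_nonzero[OF elim] by (simp add: \<mu>_def norm_divide power_divide)
        also have "\<dots> = (cmod (\<mu> z))\<^sup>2 / N * poisson_sum z"
          by (simp add: cmod_J_sqrt_bd[OF elim])
        finally show ?case using poisson_sum_pos[OF elim]
          by (simp add: indicator_def flip: ennreal_mult)
      qed
    qed
    also have "\<dots> = (\<integral>\<^sup>+z. (\<Sum>i<N. indicator E (b (preim i z)) * ennreal ((cmod (\<mu> (preim i z)))\<^sup>2 / N)) \<partial>circle_measure)"
      by (rule nn_integral_poisson_sum) measurable
    also have "\<dots> = (\<integral>\<^sup>+z. G z * indicator E z \<partial>circle_measure)"
    proof (rule nn_integral_cong_AE)
      show "AE z in circle_measure. (\<Sum>i<N. indicator E (b (preim i z)) * ennreal ((cmod (\<mu> (preim i z)))\<^sup>2 / N))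
        = G z * indicator E z"
        using AE_circle_measure_cmod
      proof eventually_elim
        case (elim z)
        then show ?case by (cases "z \<in> E") (simp_all add: blaschke_preim G_def)
      qed
    qed
    also have "\<dots> = emeasure (density circle_measure G) E"
      by (simp add: emeasure_density)
    finally have "emeasure (density circle_measure G) E = nn_norm2 (S j ?i)" by simp
    also have "\<dots> = nn_norm2 ?i" by (rule cuntz_family_isometry[OF cf Linf_imp_L2[OF i] j])
    also have "\<dots> = (\<integral>\<^sup>+z. indicator E z \<partial>circle_measure)"
      unfolding nn_norm2_def by (intro nn_integral_cong) (simp add: indicator_def)
    also have "\<dots> = emeasure (density circle_measure (\<lambda>_. 1)) E"
      by (simp add: emeasure_density)
    finally show "emeasure (density circle_measure G) E = emeasure (density circle_measure (\<lambda>_. 1)) E" .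
  qed simp
  have "AE z in circle_measure. G z = 1"
    using dens by (subst (asm) circle.density_unique_iff) auto
  \<comment> \<open>After pulling back along b, the fibre in question contains z itself, so the term
    at z is bounded by a sum of nonnegative terms equal to 1.\<close>
  then have "AE z in circle_measure. G (b z) = 1" by (rule AE_blaschke)
  then have "AE z in circle_measure. cmod (\<mu> z) \<le> sqrt N"
    using AE_circle_measure_cmod
  proof eventually_elim
    case (elim z)
    have bz: "cmod (b z) = 1" using elim(2) by (simp add: cmod_blaschke_eq_1_iff)
    have "z \<in> {w. b w = b z}" by simp
    then obtain i where i: "i \<in> {..<N}" "z = preim i (b z)" unfolding fiber_eq[OF bz] by blast
    have "ennreal ((cmod (\<mu> (preim i (b z))))\<^sup>2 / N) \<le> G (b z)"
      unfolding G_def using i(1) by (intro member_le_sum) auto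
    then have "ennreal ((cmod (\<mu> z))\<^sup>2 / N) \<le> ennreal 1"
      unfolding i(2)[symmetric] elim(1) by simp
    then have "(cmod (\<mu> z))\<^sup>2 / N \<le> 1" by (subst (asm) ennreal_le_iff) auto
    then have "(cmod (\<mu> z))\<^sup>2 \<le> N" using N_pos by (simp add: divide_le_eq)
    then show ?case by (rule real_le_rsqrt)
  qed
  then show ?thesis unfolding \<mu>_def[symmetric] Linf_def by auto
qed

text \<open>The intertwining relation needs a bounded symbol, while f is only in L^2. With g = 1 /
  (1 + |f|) both g and g f are bounded; S_j (g f) is computed with symbol g acting on f and with
  symbol g f acting on 1, and g(b z), which never vanishes, cancels.\<close>

lemma cuntz_family_eq_W:
  assumes cf: "cuntz_family N S"
    and al: "\<And>\<phi>. Linf \<phi> \<Longrightarrow> op_eq (alpha_S N S (mult_op \<phi>)) (mult_op (beta b \<phi>))"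
    and j: "j < N"
  shows "op_eq (S j) (W (\<lambda>z. S j (\<lambda>_. 1) z / k z))"
  unfolding op_eq_def
proof (intro allI impI)
  fix f assume f: "L2 f"
  note [measurable] = L2_measurable[OF f]
  define g where "g z = (1 / (1 + complex_of_real (cmod (f z))))" for z
  have nz: "1 + complex_of_real (cmod w) \<noteq> 0" for w
    by (metis add_pos_nonneg norm_ge_zero of_real_1 of_real_add of_real_eq_0_iff order_less_irrefl zero_less_one)
  have c1: "cmod (1 + complex_of_real (cmod w)) = 1 + cmod w" for w
    by (metis abs_of_nonneg add_nonneg_nonneg norm_ge_zero norm_of_real of_real_1 of_real_add zero_le_one)
  have g: "Linf g" and fg: "Linf (\<lambda>z. g z * f z)"
    unfolding Linf_def g_def
    by (auto intro!: exI[of _ 1] AE_I2 simp: norm_divide norm_mult c1 divide_le_eq add_pos_nonneg)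
  have "AE z in circle_measure. S j (\<lambda>w. g w * f w) z = g (b z) * S j f z"
    by (rule cuntz_family_intertwines[OF cf al[OF g] g f j])
  moreover have "AE z in circle_measure. S j (\<lambda>w. (g w * f w) * 1) z = (g (b z) * f (b z)) * S j (\<lambda>_. 1) z"
    by (rule cuntz_family_intertwines[OF cf al[OF fg] fg L2_const j])
  ultimately show "AE z in circle_measure. S j f z = W (\<lambda>z. S j (\<lambda>_. 1) z / k z) f z"
    using AE_circle_measure_cmod
  proof eventually_elim
    case (elim z)
    have "g (b z) \<noteq> 0" using nz by (simp add: g_def)
    then have "S j f z = f (b z) * S j (\<lambda>_. 1) z" using elim(1,2) by simp
    then show ?case using J_sqrt_bd_nonzero[OF elim(3)] by (simp add: W_eq)
  qed
qed

end

theorem theorem5p1: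
  fixes N :: nat and \<alpha> :: "nat \<Rightarrow> complex"
  assumes "N \<ge> 1" and "\<forall>j<N. cmod (\<alpha> j) < 1"
  shows
   "(\<forall>S. cuntz_family N S \<and>
         (\<forall>\<phi>. Linf \<phi> \<longrightarrow> op_eq (alpha_S N S (mult_op \<phi>)) (mult_op (beta (blaschke N \<alpha>) \<phi>)))
       \<longrightarrow> (\<exists>m. module_onb N (blaschke N \<alpha>) m \<and>
                 (\<forall>i<N. op_eq (S i) (\<lambda>f. mult_op (m i) (C_b N \<alpha> f))))) \<and>
    (\<forall>m. (\<forall>i<N. Linf (m i)) \<and>
         cuntz_family N (\<lambda>i f. mult_op (m i) (C_b N \<alpha> f)) \<and>
         (\<forall>\<phi>. Linf \<phi> \<longrightarrow> op_eq (alpha_S N (\<lambda>i f. mult_op (m i) (C_b N \<alpha> f)) (mult_op \<phi>))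
                                 (mult_op (beta (blaschke N \<alpha>) \<phi>)))
       \<longrightarrow> module_onb N (blaschke N \<alpha>) m) \<and>
    (\<forall>m. module_onb N (blaschke N \<alpha>) m
       \<longrightarrow> cuntz_family N (\<lambda>i f. mult_op (m i) (C_b N \<alpha> f)) \<and>
           (\<forall>\<phi>. Linf \<phi> \<longrightarrow> op_eq (alpha_S N (\<lambda>i f. mult_op (m i) (C_b N \<alpha> f)) (mult_op \<phi>))
                                   (mult_op (beta (blaschke N \<alpha>) \<phi>))))"
proof -
  interpret blaschke_product N \<alpha> using assms by unfold_locales
  show ?thesis
  proof (intro conjI allI impI)
    fix S
    assume "cuntz_family N S \<and>
      (\<forall>\<phi>. Linf \<phi> \<longrightarrow> op_eq (alpha_S N S (mult_op \<phi>)) (mult_op (beta (blaschke N \<alpha>) \<phi>)))"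
    then have S: "cuntz_family N S"
      "\<And>\<phi>. Linf \<phi> \<Longrightarrow> op_eq (alpha_S N S (mult_op \<phi>)) (mult_op (beta (blaschke N \<alpha>) \<phi>))" by auto
    \<comment> \<open>The only candidate: evaluating S_i = pi(m_i) C_b at the constant 1 gives m_i
      k.\<close>
    let ?m = "\<lambda>i z. S i (\<lambda>_. 1) z / k z"
    have eq: "op_eq (S i) (W (?m i))" if "i < N" for i
      by (rule cuntz_family_eq_W[OF S that])
    have "module_onb N (blaschke N \<alpha>) ?m"
      by (rule onb_of_cuntz_family[OF S(1) cuntz_family_generator_bounded[OF S] eq])
    then show "\<exists>m. module_onb N (blaschke N \<alpha>) m \<and>
        (\<forall>i<N. op_eq (S i) (\<lambda>f. mult_op (m i) (C_b N \<alpha> f)))"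
      using eq by blast
  next
    fix m
    assume "(\<forall>i<N. Linf (m i)) \<and> cuntz_family N (\<lambda>i. W (m i)) \<and>
         (\<forall>\<phi>. Linf \<phi> \<longrightarrow> op_eq (alpha_S N (\<lambda>i. W (m i)) (mult_op \<phi>))
                                 (mult_op (beta (blaschke N \<alpha>) \<phi>)))"
    then show "module_onb N (blaschke N \<alpha>) m"
      by (intro onb_of_cuntz_family[of "\<lambda>i. W (m i)"]) (auto simp: op_eq_def)
  next
    fix m assume "module_onb N (blaschke N \<alpha>) m"
    then show "cuntz_family N (\<lambda>i. W (m i))" by (rule cuntz_family_of_onb)
    then show "op_eq (alpha_S N (\<lambda>i. W (m i)) (mult_op \<phi>)) (mult_op (beta (blaschke N \<alpha>) \<phi>))" for \<phi>
      by (rule alpha_S_W)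
  qed
qed

end
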